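(* With rows and columns indexed by the Young diagrams with $k$ boxes, $0\le k\le n$, ordered so that diagrams with $r$ boxes appear before diagrams with $k$ boxes whenever $r<k$, the Cartan matrix of $\mathbb{C}\mathcal{SE}_n$ is block upper unitriangular.
   Context: Composition of functions is from right to left. $\mathcal{SE}_n$ is the category with objects $0,1,\ldots,n$ whose hom-set $\mathcal{SE}_n(r,k)$ of morphisms from $r$ to $k$ consists of all onto total functions $\{1,\ldots,r\}\to\{1,\ldots,k\}$ (with $\{1,\ldots,0\}=\varnothing$). Its category algebra $\mathbb{C}\mathcal{SE}_n$ is the $\mathbb{C}$-vector space with basis all morphisms, with product $m'\cdot m=m'm$ if the composition is defined and $0$ otherwise. Modules are finite dimensional left modules. Young diagrams are identified with integer partitions; $0$ has exactly one partition, $\varnothing$. For $\alpha\vdash k$, $S^\alpha$ is the Specht module over $\mathbb{C}S_k$. We have $\mathcal{SE}_n(k,k)=S_k$, so $\mathbb{C}S_k\subseteq\mathbb{C}\mathcal{SE}_n$. For $\alpha\vdash k$ with $0\le k\le n$, let $e_\alpha\in\mathbb{C}S_k$ be a primitive idempotent with $\mathbb{C}S_ke_\alpha\simeq S^\alpha$; put $P(\alpha)=\mathbb{C}\mathcal{SE}_n\,e_\alpha$ and $S(\alpha)=P(\alpha)/\mathrm{Rad}\,P(\alpha)$. These give complete lists, up to isomorphism, of the indecomposable projective and the simple $\mathbb{C}\mathcal{SE}_n$-modules. The $(\beta,\alpha)$ entry of the Cartan matrix is the number of times that $S(\beta)$ appears as a Jordan-Hölder factor of $P(\alpha)$. The matrix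 is viewed as an $(n+1)\times(n+1)$ block matrix whose $(i,j)$ block contains the entries $(\beta,\alpha)$ with $\beta\vdash i-1$ and $\alpha\vdash j-1$. Block upper unitriangular means that all blocks below the diagonal are zero and all diagonal blocks are identity matrices. *)

theory Defs
  imports
    Complex_Main
    "HOL-Library.FuncSet"
    "HOL-Combinatorics.Permutations"
    "HOL-Algebra.Module"
    "HOL-Algebra.AbelCoset"
    "Jordan_Normal_Form.DL_Submatrix"
begin

section \<open>Left modules over a not necessarily commutative ring\<close>

text \<open>
  The locale \<open>module\<close> of HOL-Algebra asks for a commutative ring of scalars. Only its
  record type and its notion of submodule, neither of which needs commutativity, are used here.
  The record type extends that of rings; the fields for the multiplication and the unit
  are never used for modules.
\<close>

definition module_iso ::
  "('a, 'r) ring_scheme \<Rightarrow> ('a, 'm) module \<Rightarrow> ('a, 'k) module \<Rightarrow> bool" where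
  "module_iso R M N \<longleftrightarrow>
    (\<exists>\<phi>. bij_betw \<phi> (carrier M) (carrier N) \<and>
         (\<forall>x\<in>carrier M. \<forall>y\<in>carrier M. \<phi> (x \<oplus>\<^bsub>M\<^esub> y) = \<phi> x \<oplus>\<^bsub>N\<^esub> \<phi> y) \<and>
         (\<forall>a\<in>carrier R. \<forall>x\<in>carrier M. \<phi> (a \<odot>\<^bsub>M\<^esub> x) = a \<odot>\<^bsub>N\<^esub> \<phi> x))"

definition quotient_module :: "('a, 'm) module \<Rightarrow> 'm set \<Rightarrow> ('a, 'm set) module" where
  "quotient_module M N =
    \<lparr>carrier = a_rcosets\<^bsub>M\<^esub> N, monoid.mult = undefined, one = undefined,
     zero = N, add = set_add M,
     smult = (\<lambda>a X. N <+>\<^bsub>M\<^esub> ((\<lambda>x. a \<odot>\<^bsub>M\<^esub> x) ` X))\<rparr>"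

definition simple_module :: "('a, 'r) ring_scheme \<Rightarrow> ('a, 'm) module \<Rightarrow> bool" where
  "simple_module R M \<longleftrightarrow>
    carrier M \<noteq> {\<zero>\<^bsub>M\<^esub>} \<and> (\<forall>N. submodule N R M \<longrightarrow> N = {\<zero>\<^bsub>M\<^esub>} \<or> N = carrier M)"

definition maximal_submodule :: "('a, 'r) ring_scheme \<Rightarrow> ('a, 'm) module \<Rightarrow> 'm set \<Rightarrow> bool" where
  "maximal_submodule R M N \<longleftrightarrow>
    submodule N R M \<and> N \<noteq> carrier M \<and>
    (\<forall>N'. submodule N' R M \<longrightarrow> N \<subseteq> N' \<longrightarrow> N' = N \<or> N' = carrier M)"

definition module_radical :: "('a, 'r) ring_scheme \<Rightarrow> ('a, 'm) module \<Rightarrow> 'm set" where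
  "module_radical R M = carrier M \<inter> \<Inter> {N. maximal_submodule R M N}"

definition series_factor :: "('a, 'm) module \<Rightarrow> 'm set list \<Rightarrow> nat \<Rightarrow> ('a, 'm set) module" where
  "series_factor M Ns i = quotient_module (M\<lparr>carrier := Ns ! Suc i\<rparr>) (Ns ! i)"

definition composition_series ::
  "('a, 'r) ring_scheme \<Rightarrow> ('a, 'm) module \<Rightarrow> 'm set list \<Rightarrow> bool" where
  "composition_series R M Ns \<longleftrightarrow>
    Ns \<noteq> [] \<and> hd Ns = {\<zero>\<^bsub>M\<^esub>} \<and> last Ns = carrier M \<and> (\<forall>N\<in>set Ns. submodule N R M) \<and>
    (\<forall>i. Suc i < length Ns \<longrightarrow>
      Ns ! i \<subseteq> Ns ! Suc i \<and> simple_module R (series_factor M Ns i))"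

text \<open>
  The number of times that \<open>S\<close> appears as a Jordan-Hoelder factor of \<open>M\<close>, which by the
  Jordan-Hoelder theorem is the same for all composition series of a module of finite length.
\<close>

definition jh_multiplicity ::
  "('a, 'r) ring_scheme \<Rightarrow> ('a, 'm) module \<Rightarrow> ('a, 'k) module \<Rightarrow> nat" where
  "jh_multiplicity R M S =
    (THE c. \<exists>Ns. composition_series R M Ns \<and>
       c = card {i. Suc i < length Ns \<and> module_iso R (series_factor M Ns i) S})"

definition primitive_idempotent :: "('a, 'r) ring_scheme \<Rightarrow> 'a \<Rightarrow> bool" where
  "primitive_idempotent R e \<longleftrightarrow>
    e \<in> carrier R \<and> e \<otimes>\<^bsub>R\<^esub> e = e \<and> e \<noteq> \<zero>\<^bsub>R\<^esub> \<and>
    \<not> (\<exists>f\<in>carrier R. \<exists>g\<in>carrier R.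
         f \<noteq> \<zero>\<^bsub>R\<^esub> \<and> g \<noteq> \<zero>\<^bsub>R\<^esub> \<and> f \<otimes>\<^bsub>R\<^esub> f = f \<and> g \<otimes>\<^bsub>R\<^esub> g = g \<and>
         f \<otimes>\<^bsub>R\<^esub> g = \<zero>\<^bsub>R\<^esub> \<and> g \<otimes>\<^bsub>R\<^esub> f = \<zero>\<^bsub>R\<^esub> \<and> e = f \<oplus>\<^bsub>R\<^esub> g)"

definition left_ideal_module :: "('a, 'r) ring_scheme \<Rightarrow> 'a \<Rightarrow> ('a, 'a) module" where
  "left_ideal_module R e =
    \<lparr>carrier = (\<lambda>x. x \<otimes>\<^bsub>R\<^esub> e) ` carrier R, monoid.mult = undefined, one = undefined,
     zero = \<zero>\<^bsub>R\<^esub>, add = add R, smult = monoid.mult R\<rparr>"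


section \<open>The category of epimorphisms and its algebra\<close>

text \<open>
  A morphism from \<open>r\<close> to \<open>k\<close> is a triple \<open>(r, k, f)\<close>; extensionality makes \<open>f\<close>
  a function on \<open>{1..r}\<close> only.
\<close>

type_synonym se_mor = "nat \<times> nat \<times> (nat \<Rightarrow> nat)"

definition SE_hom :: "nat \<Rightarrow> nat \<Rightarrow> se_mor set" where
  "SE_hom r k = {(r, k, f) | f. f \<in> extensional {1..r} \<and> f ` {1..r} = {1..k}}"

definition SE_mors :: "nat set \<Rightarrow> se_mor set" where
  "SE_mors Ob = (\<Union>r\<in>Ob. \<Union>k\<in>Ob. SE_hom r k)"

definition SE_composable :: "se_mor \<Rightarrow> se_mor \<Rightarrow> bool" where
  "SE_composable m' m \<longleftrightarrow> fst m' = fst (snd m)"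

definition SE_comp :: "se_mor \<Rightarrow> se_mor \<Rightarrow> se_mor" where
  "SE_comp m' m =
    (fst m, fst (snd m'), compose {1..fst m} (snd (snd m')) (snd (snd m)))"

definition SE_id :: "nat \<Rightarrow> se_mor" where
  "SE_id k = (k, k, restrict id {1..k})"

text \<open>
  The complex category algebra of the full subcategory on a finite set \<open>Ob\<close> of objects. A
  function \<open>x\<close> stands for the formal linear combination of all morphisms \<open>m\<close> with
  coefficients \<open>x m\<close>. The field of complex numbers acts through the multiples of the unit,
  so module homomorphisms over this ring are automatically complex linear.
\<close>

definition SE_algebra :: "nat set \<Rightarrow> (se_mor \<Rightarrow> complex) ring" where
  "SE_algebra Ob =
    \<lparr>carrier = {x. \<forall>m. m \<notin> SE_mors Ob \<longrightarrow> x m = 0},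
     monoid.mult = (\<lambda>x y m. \<Sum>(p, q) \<in> {(p, q). p \<in> SE_mors Ob \<and> q \<in> SE_mors Ob \<and>
                                    SE_composable p q \<and> SE_comp p q = m}. x p * y q),
     one = (\<lambda>m. if m \<in> SE_id ` Ob then 1 else 0),
     zero = (\<lambda>m. 0),
     add = (\<lambda>x y m. x m + y m)\<rparr>"

abbreviation CSE :: "nat \<Rightarrow> (se_mor \<Rightarrow> complex) ring" where
  "CSE n \<equiv> SE_algebra {0..n}"

text \<open>
  The group algebra of the symmetric group on \<open>{1..k}\<close>. For \<open>k \<le> n\<close> its elements
  literally are elements of \<open>CSE n\<close>, multiplied in the same way.
\<close>

abbreviation CS :: "nat \<Rightarrow> (se_mor \<Rightarrow> complex) ring" where
  "CS k \<equiv> SE_algebra {k}"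


section \<open>Young diagrams and Specht modules\<close>

definition young_diagrams :: "nat \<Rightarrow> nat list set" where
  "young_diagrams k = {\<alpha>. sorted_wrt (\<ge>) \<alpha> \<and> 0 \<notin> set \<alpha> \<and> sum_list \<alpha> = k}"

definition cells :: "nat list \<Rightarrow> (nat \<times> nat) set" where
  "cells \<alpha> = {(i, j). i < length \<alpha> \<and> j < \<alpha> ! i}"

definition tableaux :: "nat list \<Rightarrow> (nat \<times> nat \<Rightarrow> nat) set" where
  "tableaux \<alpha> = {t \<in> extensional (cells \<alpha>). bij_betw t (cells \<alpha>) {1..sum_list \<alpha>}}"

definition row_entries :: "nat list \<Rightarrow> (nat \<times> nat \<Rightarrow> nat) \<Rightarrow> nat \<Rightarrow> nat set" where
  "row_entries \<alpha> t i = t ` {c \<in> cells \<alpha>. fst c = i}"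

definition column_entries :: "nat list \<Rightarrow> (nat \<times> nat \<Rightarrow> nat) \<Rightarrow> nat \<Rightarrow> nat set" where
  "column_entries \<alpha> t j = t ` {c \<in> cells \<alpha>. snd c = j}"

definition tabloid :: "nat list \<Rightarrow> (nat \<times> nat \<Rightarrow> nat) \<Rightarrow> (nat \<times> nat \<Rightarrow> nat) set" where
  "tabloid \<alpha> t = {s \<in> tableaux \<alpha>. \<forall>i. row_entries \<alpha> s i = row_entries \<alpha> t i}"

definition column_stabilizer :: "nat list \<Rightarrow> (nat \<times> nat \<Rightarrow> nat) \<Rightarrow> (nat \<Rightarrow> nat) set" where
  "column_stabilizer \<alpha> t =
    {\<pi>. \<pi> permutes {1..sum_list \<alpha>} \<and>
        (\<forall>j. \<pi> ` column_entries \<alpha> t j = column_entries \<alpha> t j)}"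

text \<open>
  Elements of the permutation module are formal linear combinations of tabloids, represented
  by their coefficient functions. The polytabloid of \<open>t\<close> is the signed sum of the tabloids of
  \<open>\<pi> t\<close> over the column stabilizer of \<open>t\<close>.
\<close>

definition polytabloid ::
  "nat list \<Rightarrow> (nat \<times> nat \<Rightarrow> nat) \<Rightarrow> (nat \<times> nat \<Rightarrow> nat) set \<Rightarrow> complex" where
  "polytabloid \<alpha> t = (\<lambda>T. \<Sum>\<pi> \<in> column_stabilizer \<alpha> t.
     of_int (sign \<pi>) * (if tabloid \<alpha> (compose (cells \<alpha>) \<pi> t) = T then 1 else 0))"

definition tabloid_action ::
  "nat list \<Rightarrow> se_mor \<Rightarrow> (nat \<times> nat \<Rightarrow> nat) set \<Rightarrow> (nat \<times> nat \<Rightarrow> nat) set" where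
  "tabloid_action \<alpha> m T = compose (cells \<alpha>) (snd (snd m)) ` T"

definition specht_module ::
  "nat list \<Rightarrow> (se_mor \<Rightarrow> complex, (nat \<times> nat \<Rightarrow> nat) set \<Rightarrow> complex) module" where
  "specht_module \<alpha> =
    \<lparr>carrier = {(\<lambda>T. \<Sum>t\<in>tableaux \<alpha>. c t * polytabloid \<alpha> t T) | c. True},
     monoid.mult = undefined, one = undefined, zero = (\<lambda>T. 0), add = (\<lambda>v w T. v T + w T),
     smult = (\<lambda>x v T. \<Sum>(m, U) \<in> {(m, U). m \<in> SE_hom (sum_list \<alpha>) (sum_list \<alpha>) \<and>
                                         U \<in> tabloid \<alpha> ` tableaux \<alpha> \<and>
                                         tabloid_action \<alpha> m U = T}. x m * v U)\<rparr>"


section \<open>The Cartan matrix\<close>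

definition proj_module ::
  "nat \<Rightarrow> (se_mor \<Rightarrow> complex) \<Rightarrow> (se_mor \<Rightarrow> complex, se_mor \<Rightarrow> complex) module" where
  "proj_module n f = left_ideal_module (CSE n) f"

definition top_module ::
  "nat \<Rightarrow> (se_mor \<Rightarrow> complex) \<Rightarrow> (se_mor \<Rightarrow> complex, (se_mor \<Rightarrow> complex) set) module" where
  "top_module n f = quotient_module (proj_module n f) (module_radical (CSE n) (proj_module n f))"

text \<open>
  In the following, \<open>e\<close> is a choice of a primitive idempotent for every Young diagram and \<open>ds\<close>
  is the list of the Young diagrams that index the rows and the columns.
\<close>

definition cartan_matrix ::
  "nat \<Rightarrow> (nat list \<Rightarrow> se_mor \<Rightarrow> complex) \<Rightarrow> nat list list \<Rightarrow> nat mat" where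
  "cartan_matrix n e ds =
    mat (length ds) (length ds)
      (\<lambda>(p, q). jh_multiplicity (CSE n) (proj_module n (e (ds ! q))) (top_module n (e (ds ! p))))"

text \<open>
  Blocks are numbered from 1; block \<open>(i, j)\<close> has the rows of the diagrams with \<open>i - 1\<close> boxes
  and the columns of the diagrams with \<open>j - 1\<close> boxes.
\<close>

definition diagram_block :: "nat list list \<Rightarrow> nat mat \<Rightarrow> nat \<Rightarrow> nat \<Rightarrow> nat mat" where
  "diagram_block ds C i j =
    submatrix C {p. p < length ds \<and> ds ! p \<in> young_diagrams (i - 1)}
                {q. q < length ds \<and> ds ! q \<in> young_diagrams (j - 1)}"

text \<open>Here \<open>B i j\<close> is the \<open>(i, j)\<close> block of a matrix with \<open>N\<close> times \<open>N\<close> blocks.\<close>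

definition block_upper_unitriangular :: "nat \<Rightarrow> (nat \<Rightarrow> nat \<Rightarrow> nat mat) \<Rightarrow> bool" where
  "block_upper_unitriangular N B \<longleftrightarrow>
    (\<forall>i\<in>{1..N}. \<forall>j\<in>{1..N}. j < i \<longrightarrow> B i j = 0\<^sub>m (dim_row (B i j)) (dim_col (B i j))) \<and>
    (\<forall>i\<in>{1..N}. B i i = 1\<^sub>m (dim_row (B i i)))"

end

theory Submission
  imports Defs "HOL-Library.Function_Algebras"
begin

text \<open>
  Let \<open>A\<close> be the algebra of the category, \<open>\<alpha>\<close> a partition of \<open>k\<close> and \<open>c\<close> the identity of the
  object \<open>k\<close>, viewed as an element of \<open>A\<close>. Every morphism in the support of an element of
  \<open>P(\<alpha>)\<close> has source \<open>k\<close>, hence target at most \<open>k\<close>, because morphisms are onto. For the same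
  reason nothing of target below \<open>k\<close> is ever moved back to target \<open>k\<close>, so the elements of \<open>P(\<alpha>)\<close>
  that are killed by \<open>c\<close> form a submodule. The part \<open>c P(\<alpha>)\<close> is the left ideal of the group algebra
  of \<open>S\<^sub>k\<close> generated by \<open>e\<^sub>\<alpha>\<close>. By the argument of Maschke it is simple
  (\<open>primitive_idempotent_generated\<close>), and therefore every submodule of \<open>P(\<alpha>)\<close> that is not
  killed by \<open>c\<close> contains \<open>e\<^sub>\<alpha>\<close> and is everything. So the elements killed by \<open>c\<close> are the radical.

  In a composition series of \<open>P(\<alpha>)\<close> all terms but the last lie in the radical. Hence \<open>c\<close> acts as
  zero on all factors but the last one, which is \<open>S(\<alpha>)\<close> (\<open>jh_multiplicity_top\<close>). If \<open>\<beta>\<close> is a partition of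
  \<open>l\<close>, then the identity of the object \<open>l\<close> does not act as zero on \<open>S(\<beta>)\<close>. For \<open>l > k\<close> it kills
  all of \<open>P(\<alpha>)\<close>, so \<open>S(\<beta>)\<close> does not occur; for \<open>l = k\<close> it is \<open>c\<close>, so \<open>S(\<beta>)\<close> occurs once if it is
  isomorphic to \<open>S(\<alpha>)\<close> and not at all otherwise.

  It remains to recover \<open>\<alpha>\<close> from \<open>S(\<alpha>)\<close>. An element of the group algebra of \<open>S\<^sub>k\<close> acts as zero on
  \<open>S(\<alpha>)\<close> exactly if it does on the Specht module of \<open>\<alpha>\<close> (\<open>top_acts_iff\<close>,
  \<open>ideal_acts_iff_specht\<close>), so it suffices to compare annihilators of Specht modules. The column
  antisymmetrizer of an \<open>\<alpha>\<close>-tableau does not annihilate the Specht module of \<open>\<alpha>\<close>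
  (\<open>antisymmetrizer_acts\<close>), and if it does not annihilate that of \<open>\<beta>\<close>, then \<open>\<alpha>\<close> dominates \<open>\<beta>\<close>
  (\<open>antisymmetrizer_dominance\<close>). Two Specht modules with the same annihilator thus belong to
  partitions that dominate each other, and these are equal.
\<close>

section \<open>Left modules\<close>

locale left_module = R?: ring R + M?: abelian_group M
    for R :: "('a, 'r) ring_scheme" and M :: "('a, 'm) module" (structure) +
  assumes smult_closed [simp, intro]:
      "\<lbrakk>a \<in> carrier R; x \<in> carrier M\<rbrakk> \<Longrightarrow> a \<odot> x \<in> carrier M"
    and smult_l_distr:
      "\<lbrakk>a \<in> carrier R; b \<in> carrier R; x \<in> carrier M\<rbrakk> \<Longrightarrow>
        (a \<oplus>\<^bsub>R\<^esub> b) \<odot> x = a \<odot> x \<oplus> b \<odot> x"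
    and smult_r_distr:
      "\<lbrakk>a \<in> carrier R; x \<in> carrier M; y \<in> carrier M\<rbrakk> \<Longrightarrow>
        a \<odot> (x \<oplus> y) = a \<odot> x \<oplus> a \<odot> y"
    and smult_assoc:
      "\<lbrakk>a \<in> carrier R; b \<in> carrier R; x \<in> carrier M\<rbrakk> \<Longrightarrow>
        (a \<otimes>\<^bsub>R\<^esub> b) \<odot> x = a \<odot> (b \<odot> x)"
    and smult_one [simp]: "x \<in> carrier M \<Longrightarrow> \<one>\<^bsub>R\<^esub> \<odot> x = x"

context left_module
begin

lemma smult_l_null [simp]: "x \<in> carrier M \<Longrightarrow> \<zero>\<^bsub>R\<^esub> \<odot> x = \<zero>"
proof -
  assume x: "x \<in> carrier M"
  have "\<zero>\<^bsub>R\<^esub> \<odot> x \<oplus> \<zero>\<^bsub>R\<^esub> \<odot> x = \<zero>\<^bsub>R\<^esub> \<odot> x"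
    using smult_l_distr[OF R.zero_closed R.zero_closed x] by simp
  then show ?thesis
    using x by (metis M.add.r_cancel_one' R.zero_closed smult_closed)
qed

lemma smult_r_null [simp]: "a \<in> carrier R \<Longrightarrow> a \<odot> \<zero> = \<zero>"
proof -
  assume a: "a \<in> carrier R"
  have "a \<odot> \<zero> \<oplus> a \<odot> \<zero> = a \<odot> \<zero>"
    using smult_r_distr[OF a M.zero_closed M.zero_closed] by simp
  then show ?thesis
    using a by (metis M.add.r_cancel_one' M.zero_closed smult_closed)
qed

text \<open>
  Since additive inverses are multiples by an element of the ring, submodules need no separate
  closure under them.
\<close>

lemma smult_minus_one: "x \<in> carrier M \<Longrightarrow> (\<ominus>\<^bsub>R\<^esub> \<one>\<^bsub>R\<^esub>) \<odot> x = \<ominus> x"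
proof -
  assume x: "x \<in> carrier M"
  have "(\<ominus>\<^bsub>R\<^esub> \<one>\<^bsub>R\<^esub>) \<odot> x \<oplus> x = (\<ominus>\<^bsub>R\<^esub> \<one>\<^bsub>R\<^esub> \<oplus>\<^bsub>R\<^esub> \<one>\<^bsub>R\<^esub>) \<odot> x"
    using x by (simp add: smult_l_distr)
  also have "\<dots> = \<zero>"
    using x by (simp add: R.l_neg)
  finally show ?thesis
    using x by (simp add: M.minus_equality)
qed

lemma smult_r_minus: "\<lbrakk>a \<in> carrier R; x \<in> carrier M\<rbrakk> \<Longrightarrow> a \<odot> (\<ominus> x) = \<ominus> (a \<odot> x)"
  using smult_r_distr[of a "\<ominus> x" x]
  by (simp add: M.l_neg M.minus_equality)

lemma submoduleI:
  assumes "H \<subseteq> carrier M" "\<zero> \<in> H"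
    and "\<And>x y. x \<in> H \<Longrightarrow> y \<in> H \<Longrightarrow> x \<oplus> y \<in> H"
    and sm: "\<And>a x. a \<in> carrier R \<Longrightarrow> x \<in> H \<Longrightarrow> a \<odot> x \<in> H"
  shows "submodule H R M"
proof -
  have "\<ominus> x \<in> H" if "x \<in> H" for x
    using sm[of "\<ominus>\<^bsub>R\<^esub> \<one>\<^bsub>R\<^esub>" x] that assms(1) by (auto simp: smult_minus_one)
  then show ?thesis
    using assms by unfold_locales (auto simp: a_inv_def)
qed

lemma submoduleD:
  assumes "submodule H R M"
  shows "H \<subseteq> carrier M" "\<zero> \<in> H"
    and "\<And>x y. x \<in> H \<Longrightarrow> y \<in> H \<Longrightarrow> x \<oplus> y \<in> H"
    and "\<And>a x. a \<in> carrier R \<Longrightarrow> x \<in> H \<Longrightarrow> a \<odot> x \<in> H"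
    and "\<And>x. x \<in> H \<Longrightarrow> \<ominus> x \<in> H"
proof -
  interpret submodule H R M by fact
  show "H \<subseteq> carrier M" "\<zero> \<in> H"
    and "\<And>x y. x \<in> H \<Longrightarrow> y \<in> H \<Longrightarrow> x \<oplus> y \<in> H"
    and "\<And>a x. a \<in> carrier R \<Longrightarrow> x \<in> H \<Longrightarrow> a \<odot> x \<in> H"
    using subset one_closed m_closed by auto
  show "\<And>x. x \<in> H \<Longrightarrow> \<ominus> x \<in> H"
    using m_inv_closed by (auto simp: a_inv_def)
qed

lemma submodule_zero: "submodule {\<zero>} R M"
  by (rule submoduleI) auto

lemma submodule_carrier: "submodule (carrier M) R M"
  by (rule submoduleI) auto

lemma submodule_is_left_module:
  assumes "submodule N R M"
  shows "left_module R (M\<lparr>carrier := N\<rparr>)"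
proof -
  note N = submoduleD[OF assms]
  have "abelian_group (M\<lparr>carrier := N\<rparr>)"
  proof (rule abelian_groupI)
    fix x assume "x \<in> carrier (M\<lparr>carrier := N\<rparr>)"
    then show "\<exists>y\<in>carrier (M\<lparr>carrier := N\<rparr>). y \<oplus>\<^bsub>M\<lparr>carrier := N\<rparr>\<^esub> x = \<zero>\<^bsub>M\<lparr>carrier := N\<rparr>\<^esub>"
      using N by (intro bexI[of _ "\<ominus> x"]) (auto simp: M.l_neg)
  qed (use N in \<open>auto simp: M.a_ac subset_iff\<close>)
  then show ?thesis
    using N(1,4) R.ring_axioms
    by (auto simp: left_module_def left_module_axioms_def subset_iff
        smult_l_distr smult_r_distr smult_assoc)
qed

lemma submodule_restrict_iff:
  assumes "submodule N R M"
  shows "submodule K R (M\<lparr>carrier := N\<rparr>) \<longleftrightarrow> submodule K R M \<and> K \<subseteq> N"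
proof -
  interpret N: left_module R "M\<lparr>carrier := N\<rparr>"
    using assms by (rule submodule_is_left_module)
  note N = submoduleD[OF assms]
  show ?thesis
  proof
    assume "submodule K R (M\<lparr>carrier := N\<rparr>)"
    from N.submoduleD[OF this] N(1) show "submodule K R M \<and> K \<subseteq> N"
      by (auto intro!: submoduleI)
  next
    assume "submodule K R M \<and> K \<subseteq> N"
    with submoduleD[of K] show "submodule K R (M\<lparr>carrier := N\<rparr>)"
      by (intro N.submoduleI) auto
  qed
qed

lemma submodule_abelian_subgroup: "submodule N R M \<Longrightarrow> abelian_subgroup N M"
  by (rule abelian_subgroupI3[OF additive_subgroupI])
    (auto simp: submodule_def M.abelian_group_axioms)

context
  fixes N assumes N: "submodule N R M"
begin

lemmas a_rcos_module = abelian_subgroup.a_rcos_module[OF submodule_abelian_subgroup[OF N]]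
  and a_repr_independence' = abelian_subgroup.a_repr_independence'[OF submodule_abelian_subgroup[OF N]]
  and a_rcos_self = abelian_subgroup.a_rcos_self[OF submodule_abelian_subgroup[OF N]]
  and a_rcos_const = abelian_subgroup.a_rcos_const[OF submodule_abelian_subgroup[OF N]]
  and a_rcos_sum = abelian_subgroup.a_rcos_sum[OF submodule_abelian_subgroup[OF N]]

private abbreviation Q where "Q \<equiv> quotient_module M N"

lemma quotient_simps [simp]:
  "carrier Q = (\<lambda>x. N +> x) ` carrier M" "zero Q = N" "add Q = set_add M"
  by (auto simp: quotient_module_def A_RCOSETS_def')

lemma coset_eq_iff:
  assumes "x \<in> carrier M" "y \<in> carrier M"
  shows "N +> x = N +> y \<longleftrightarrow> x \<oplus> \<ominus> y \<in> N"
  using assms a_rcos_module a_repr_independence' a_rcos_self by metis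

lemma coset_eq_self_iff: "x \<in> carrier M \<Longrightarrow> N +> x = N \<longleftrightarrow> x \<in> N"
  using a_rcos_const a_rcos_self by blast

lemma quotient_smult:
  assumes "a \<in> carrier R" "x \<in> carrier M"
  shows "a \<odot>\<^bsub>Q\<^esub> (N +> x) = N +> (a \<odot> x)"
proof -
  note N' = submoduleD[OF N]
  have "a \<odot>\<^bsub>Q\<^esub> (N +> x) = (\<Union>h\<in>N. \<Union>k\<in>N. {h \<oplus> a \<odot> (k \<oplus> x)})"
    by (auto simp: quotient_module_def set_add_def' a_r_coset_def')
  also have "\<dots> = (\<Union>h\<in>N. {h \<oplus> a \<odot> x})"
  proof (intro equalityI subsetI)
    fix z assume "z \<in> (\<Union>h\<in>N. \<Union>k\<in>N. {h \<oplus> a \<odot> (k \<oplus> x)})"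
    then obtain h k where hk: "h \<in> N" "k \<in> N" "z = h \<oplus> a \<odot> (k \<oplus> x)" by auto
    then have "z = (h \<oplus> a \<odot> k) \<oplus> a \<odot> x"
      using assms N' by (auto simp: smult_r_distr M.a_assoc subset_iff)
    moreover have "h \<oplus> a \<odot> k \<in> N"
      using hk assms N' by auto
    ultimately show "z \<in> (\<Union>h\<in>N. {h \<oplus> a \<odot> x})" by blast
  next
    fix z assume "z \<in> (\<Union>h\<in>N. {h \<oplus> a \<odot> x})"
    then obtain h where "h \<in> N" "z = h \<oplus> a \<odot> (\<zero> \<oplus> x)" using assms by auto
    then show "z \<in> (\<Union>h\<in>N. \<Union>k\<in>N. {h \<oplus> a \<odot> (k \<oplus> x)})"
      using N'(2) by blast
  qed
  also have "\<dots> = N +> (a \<odot> x)" by (simp add: a_r_coset_def')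
  finally show ?thesis .
qed

lemma quotient_left_module: "left_module R Q"
proof -
  have "abelian_group Q"
  proof (rule abelian_groupI)
    fix X assume "X \<in> carrier Q"
    then obtain x where x: "x \<in> carrier M" "X = N +> x" by auto
    then have "(N +> (\<ominus> x)) <+> X = N"
      using submoduleD(2)[OF N] by (simp add: a_rcos_sum M.l_neg coset_eq_self_iff)
    then show "\<exists>Y\<in>carrier Q. Y \<oplus>\<^bsub>Q\<^esub> X = \<zero>\<^bsub>Q\<^esub>"
      using x by auto
    have "N = N +> \<zero>"
      using submoduleD(2)[OF N] coset_eq_self_iff[of \<zero>] by simp
    then have "N <+> X = N +> (\<zero> \<oplus> x)"
      using x a_rcos_sum[of \<zero> x] by simp
    then show "\<zero>\<^bsub>Q\<^esub> \<oplus>\<^bsub>Q\<^esub> X = X" 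
      using x by simp
  next
    show "\<zero>\<^bsub>Q\<^esub> \<in> carrier Q" 
      using submoduleD(2)[OF N] coset_eq_self_iff[of \<zero>] by (auto intro!: image_eqI[of _ _ \<zero>])
  qed (auto simp: a_rcos_sum M.a_ac)
  then show ?thesis
    using R.ring_axioms
    by (auto simp: left_module_def left_module_axioms_def quotient_smult a_rcos_sum
        smult_l_distr smult_r_distr smult_assoc)
qed

lemma submodule_preimage:
  assumes "submodule K R Q"
  shows "submodule {x \<in> carrier M. N +> x \<in> K} R M"
proof -
  interpret Q: left_module R Q by (rule quotient_left_module)
  note K = Q.submoduleD[OF assms]
  show ?thesis
  proof (rule submoduleI)
    show "\<zero> \<in> {x \<in> carrier M. N +> x \<in> K}"
      using K(2) submoduleD(2)[OF N] coset_eq_self_iff[of \<zero>] by simp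
    fix x y assume "x \<in> {x \<in> carrier M. N +> x \<in> K}" "y \<in> {x \<in> carrier M. N +> x \<in> K}"
    then show "x \<oplus> y \<in> {x \<in> carrier M. N +> x \<in> K}"
      using K(3)[of "N +> x" "N +> y"] by (auto simp: a_rcos_sum)
  next
    fix a x assume "a \<in> carrier R" "x \<in> {x \<in> carrier M. N +> x \<in> K}"
    then show "a \<odot> x \<in> {x \<in> carrier M. N +> x \<in> K}"
      using K(4)[of a "N +> x"] by (auto simp: quotient_smult)
  qed auto
qed

lemma submodule_image:
  assumes "submodule U R M"
  shows "submodule ((\<lambda>x. N +> x) ` U) R Q"
proof -
  interpret Q: left_module R Q by (rule quotient_left_module)
  note U = submoduleD[OF assms]
  show ?thesis
  proof (rule Q.submoduleI)
    show "\<zero>\<^bsub>Q\<^esub> \<in> (\<lambda>x. N +> x) ` U"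
      using U(2) submoduleD(2)[OF N] coset_eq_self_iff[of \<zero>] by (auto intro!: image_eqI[of _ _ \<zero>])
  next
    fix X Y assume "X \<in> (\<lambda>x. N +> x) ` U" "Y \<in> (\<lambda>x. N +> x) ` U"
    then obtain x y where "x \<in> U" "y \<in> U" "X = N +> x" "Y = N +> y" by blast
    then show "X \<oplus>\<^bsub>Q\<^esub> Y \<in> (\<lambda>x. N +> x) ` U"
      using U(1,3) by (auto simp: a_rcos_sum subset_iff intro!: image_eqI)
  next
    fix a X assume "a \<in> carrier R" "X \<in> (\<lambda>x. N +> x) ` U"
    then obtain x where "x \<in> U" "X = N +> x" by blast
    then show "a \<odot>\<^bsub>Q\<^esub> X \<in> (\<lambda>x. N +> x) ` U"
      using U(1,4) \<open>a \<in> carrier R\<close> quotient_smult[of a x] by auto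
  qed (use U(1) in auto)
qed

text \<open>
  The passage from \<open>U \<supseteq> N\<close> to its image in the quotient loses no information.
\<close>

lemma mem_coset_image_iff:
  assumes "submodule U R M" "N \<subseteq> U" "x \<in> carrier M"
  shows "N +> x \<in> (\<lambda>x. N +> x) ` U \<longleftrightarrow> x \<in> U"
proof
  note U = submoduleD[OF assms(1)]
  assume "N +> x \<in> (\<lambda>x. N +> x) ` U"
  then obtain u where u: "u \<in> U" "N +> x = N +> u" by blast
  then have "x \<oplus> \<ominus> u \<in> U"
    using assms U(1) coset_eq_iff[of x u] by auto
  then have "(x \<oplus> \<ominus> u) \<oplus> u \<in> U"
    using u U(3) by blast
  then show "x \<in> U"
    using u U(1) assms(3) by (auto simp: M.a_assoc M.l_neg subset_iff)
qed blast

text \<open>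
  Taking images and preimages under the projection matches the submodules of the quotient with
  the submodules that contain \<open>N\<close>.
\<close>

lemma simple_quotient_iff:
  "simple_module R Q \<longleftrightarrow> maximal_submodule R M N"
proof
  assume simp: "simple_module R Q"
  have "U = N \<or> U = carrier M" if U: "submodule U R M" "N \<subseteq> U" for U
  proof -
    have "(\<lambda>x. N +> x) ` U = {N} \<or> (\<lambda>x. N +> x) ` U = (\<lambda>x. N +> x) ` carrier M"
      using simp submodule_image[OF U(1)] by (auto simp: simple_module_def)
    then show ?thesis
    proof
      assume eq: "(\<lambda>x. N +> x) ` U = {N}"
      have "x \<in> N" if "x \<in> U" for x
        using imageI[OF that, of "\<lambda>x. N +> x"] submoduleD(1)[OF U(1)] coset_eq_self_iff[of x] that
        unfolding eq by blast
      with U show ?thesis by blast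
    next
      assume eq: "(\<lambda>x. N +> x) ` U = (\<lambda>x. N +> x) ` carrier M"
      have "x \<in> U" if "x \<in> carrier M" for x
        using imageI[OF that, of "\<lambda>x. N +> x"] mem_coset_image_iff[OF U that] eq by simp
      with submoduleD(1)[OF U(1)] show ?thesis by blast
    qed
  qed
  moreover have "N \<noteq> carrier M"
  proof
    assume eq: "N = carrier M"
    have "N +> x = N" if "x \<in> carrier M" for x
      using that unfolding eq[symmetric] by (rule a_rcos_const)
    then have "(\<lambda>x. N +> x) ` carrier M = {N}"
      using M.zero_closed by blast
    then show False
      using simp by (simp add: simple_module_def)
  qed
  ultimately show "maximal_submodule R M N"
    using N by (simp add: maximal_submodule_def)
next
  assume max: "maximal_submodule R M N"
  have "K = {N} \<or> K = (\<lambda>x. N +> x) ` carrier M" if K: "submodule K R Q" for K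
  proof -
    interpret Q: left_module R Q by (rule quotient_left_module)
    let ?U = "{x \<in> carrier M. N +> x \<in> K}"
    have KU: "K = (\<lambda>x. N +> x) ` ?U"
      using Q.submoduleD(1)[OF K] by auto
    have "N \<subseteq> ?U"
      using Q.submoduleD(2)[OF K] submoduleD(1)[OF N] a_rcos_const by auto
    then have "?U = N \<or> ?U = carrier M"
      using max submodule_preimage[OF K] by (auto simp: maximal_submodule_def)
    then show ?thesis
    proof
      assume "?U = N"
      moreover have "(\<lambda>x. N +> x) ` N = {N}"
        using submoduleD(2)[OF N] by (auto simp: a_rcos_const intro!: image_eqI[of _ _ \<zero>])
      ultimately show ?thesis
        using KU by simp
    qed (use KU in simp)
  qed
  moreover have "(\<lambda>x. N +> x) ` carrier M \<noteq> {N}"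
  proof
    assume eq: "(\<lambda>x. N +> x) ` carrier M = {N}"
    have "x \<in> N" if "x \<in> carrier M" for x
      using imageI[OF that, of "\<lambda>x. N +> x"] coset_eq_self_iff[OF that] unfolding eq by simp
    then show False
      using max submoduleD(1)[OF N] by (auto simp: maximal_submodule_def)
  qed
  ultimately show "simple_module R Q"
    by (simp add: simple_module_def)
qed

end

section \<open>Composition series\<close>

lemma simple_factor_iff:
  assumes "submodule U R M" "submodule V R M" "U \<subseteq> V"
  shows "simple_module R (quotient_module (M\<lparr>carrier := V\<rparr>) U) \<longleftrightarrow>
    U \<noteq> V \<and> (\<forall>W. submodule W R M \<longrightarrow> U \<subseteq> W \<longrightarrow> W \<subseteq> V \<longrightarrow> W = U \<or> W = V)"
proof -
  have "submodule U R (M\<lparr>carrier := V\<rparr>)"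
    using assms submodule_restrict_iff by blast
  note simple_iff = left_module.simple_quotient_iff[OF submodule_is_left_module[OF assms(2)] this]
  show ?thesis
    unfolding simple_iff maximal_submodule_def submodule_restrict_iff[OF assms(2)]
    using assms by auto
qed

text \<open>
  The function \<open>d\<close> stands for a dimension: since it is bounded by \<open>d V\<close> on the submodules of \<open>V\<close>,
  a proper submodule of \<open>V\<close> with the largest value is maximal, and one continues with it.
\<close>

lemma composition_series_exists:
  fixes d :: "'m set \<Rightarrow> nat"
  assumes d: "\<And>U V. submodule U R M \<Longrightarrow> submodule V R M \<Longrightarrow> U \<subset> V \<Longrightarrow> d U < d V"
  shows "\<exists>Ns. composition_series R M Ns"
proof -
  define chain where "chain Ns V \<longleftrightarrow> Ns \<noteq> [] \<and> hd Ns = {\<zero>} \<and> last Ns = V \<and>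
      (\<forall>N\<in>set Ns. submodule N R M) \<and>
      (\<forall>i. Suc i < length Ns \<longrightarrow> Ns ! i \<subseteq> Ns ! Suc i \<and> simple_module R (series_factor M Ns i))"
    for Ns and V
  have "\<exists>Ns. chain Ns V" if "submodule V R M" for V
    using that
  proof (induction "d V" arbitrary: V rule: less_induct)
    case less
    show ?case
    proof (cases "V = {\<zero>}")
      case True
      then have "chain [{\<zero>}] V"
        by (simp add: chain_def submodule_zero)
      then show ?thesis by blast
    next
      case False
      let ?P = "\<lambda>U. submodule U R M \<and> U \<subset> V"
      have "?P {\<zero>}"
        using False submoduleD(2)[OF less.prems] submodule_zero by blast
      moreover have "\<forall>U. ?P U \<longrightarrow> d U < d V"
        using d less.prems by blast
      ultimately obtain U where U: "?P U" and max: "\<And>W. ?P W \<Longrightarrow> d W \<le> d U"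
        using ex_has_greatest_nat[of ?P "{\<zero>}" d "d V"] by auto
      obtain Ns where Ns: "chain Ns U"
        using less.hyps[of U] d[of U V] U less.prems by auto
      have simple: "simple_module R (quotient_module (M\<lparr>carrier := V\<rparr>) U)"
        using U less.prems max d by (subst simple_factor_iff) (auto simp flip: not_less)
      have "Ns @ [V] \<noteq> [] \<and> hd (Ns @ [V]) = {\<zero>} \<and> last (Ns @ [V]) = V \<and>
          (\<forall>N\<in>set (Ns @ [V]). submodule N R M)"
        using Ns less.prems by (auto simp: chain_def)
      moreover have "(Ns @ [V]) ! i \<subseteq> (Ns @ [V]) ! Suc i \<and>
          simple_module R (series_factor M (Ns @ [V]) i)" if i: "Suc i < length (Ns @ [V])" for i
      proof (cases "Suc i < length Ns")
        case True
        then show ?thesis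
          using Ns by (simp add: chain_def nth_append series_factor_def)
      next
        case False
        with i have "Suc i = length Ns" by simp
        moreover from this have "Ns ! i = U"
          using Ns by (metis chain_def diff_Suc_1 last_conv_nth)
        ultimately show ?thesis
          using simple U by (auto simp: nth_append series_factor_def)
      qed
      ultimately have "chain (Ns @ [V]) V" 
        unfolding chain_def by blast
      then show ?thesis by blast
    qed
  qed
  then show ?thesis
    using submodule_carrier unfolding chain_def composition_series_def by blast
qed

lemma jh_multiplicity_eqI:
  assumes "\<exists>Ns. composition_series R M Ns"
    and "\<And>Ns. composition_series R M Ns \<Longrightarrow>
      card {i. Suc i < length Ns \<and> module_iso R (series_factor M Ns i) T} = c"
  shows "jh_multiplicity R M T = c"
  unfolding jh_multiplicity_def using assms by (intro the_equality) blast+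

end

text \<open>
  In a module the action of \<open>a\<close> is constant exactly if it is zero. Avoiding the zero makes
  the notion visibly invariant under \<open>module_iso\<close>, which does not mention the zeros.
\<close>

definition acts_nonconstantly :: "('a, 'm) module \<Rightarrow> 'a \<Rightarrow> bool" where
  "acts_nonconstantly M a \<longleftrightarrow> (\<exists>x\<in>carrier M. \<exists>y\<in>carrier M. a \<odot>\<^bsub>M\<^esub> x \<noteq> a \<odot>\<^bsub>M\<^esub> y)"

lemma acts_nonconstantly_iso:
  assumes "module_iso R M T" and "a \<in> carrier R"
    and closed: "\<And>x. x \<in> carrier M \<Longrightarrow> a \<odot>\<^bsub>M\<^esub> x \<in> carrier M"
  shows "acts_nonconstantly M a \<longleftrightarrow> acts_nonconstantly T a"
proof -
  obtain \<phi> where bij: "bij_betw \<phi> (carrier M) (carrier T)"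
    and hom: "\<And>x. x \<in> carrier M \<Longrightarrow> \<phi> (a \<odot>\<^bsub>M\<^esub> x) = a \<odot>\<^bsub>T\<^esub> \<phi> x"
    using assms(1,2) by (auto simp: module_iso_def)
  have "a \<odot>\<^bsub>M\<^esub> x = a \<odot>\<^bsub>M\<^esub> y \<longleftrightarrow> a \<odot>\<^bsub>T\<^esub> \<phi> x = a \<odot>\<^bsub>T\<^esub> \<phi> y"
    if "x \<in> carrier M" "y \<in> carrier M" for x y
    using that hom closed bij by (metis bij_betw_imp_inj_on inj_on_eq_iff)
  moreover have "carrier T = \<phi> ` carrier M"
    using bij by (simp add: bij_betw_def)
  ultimately show ?thesis
    by (auto simp: acts_nonconstantly_def)
qed

lemma module_iso_refl: "module_iso R M M"
  unfolding module_iso_def by (rule exI[of _ id]) auto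

context left_module
begin

text \<open>
  An element that kills \<open>V\<close> acts constantly on every quotient of \<open>V\<close>.
\<close>

lemma factor_not_iso:
  assumes "submodule U R M" "submodule V R M" "U \<subseteq> V" "a \<in> carrier R"
    and zero: "\<And>x. x \<in> V \<Longrightarrow> a \<odot> x = \<zero>" and T: "acts_nonconstantly T a"
  shows "\<not> module_iso R (quotient_module (M\<lparr>carrier := V\<rparr>) U) T"
proof
  let ?F = "quotient_module (M\<lparr>carrier := V\<rparr>) U"
  assume iso: "module_iso R ?F T"
  have U: "submodule U R (M\<lparr>carrier := V\<rparr>)"
    using assms submodule_restrict_iff by blast
  note V = submodule_is_left_module[OF assms(2)]
  note smult = left_module.quotient_smult[OF V U assms(4)]
  have "a \<odot>\<^bsub>?F\<^esub> X \<in> carrier ?F" if "X \<in> carrier ?F" for X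
    using left_module.smult_closed[OF left_module.quotient_left_module[OF V U] assms(4) that] .
  moreover have "\<not> acts_nonconstantly ?F a"
    using left_module.quotient_simps[OF V U] smult zero by (auto simp: acts_nonconstantly_def)
  ultimately show False
    using acts_nonconstantly_iso[OF iso assms(4)] T by blast
qed

lemma composition_series_submodules:
  assumes "composition_series R M Ns" "Suc i < length Ns"
  shows "submodule (Ns ! i) R M" "submodule (Ns ! Suc i) R M" "Ns ! i \<subseteq> Ns ! Suc i"
    "simple_module R (quotient_module (M\<lparr>carrier := Ns ! Suc i\<rparr>) (Ns ! i))"
  using assms by (auto simp: composition_series_def series_factor_def)

lemma composition_series_strict:
  assumes "composition_series R M Ns" "i < j" "j < length Ns"
  shows "Ns ! i \<subset> Ns ! j"
  using assms(2,3)
proof (induction j)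
  case (Suc j)
  have "Ns ! j \<subset> Ns ! Suc j"
    using composition_series_submodules[OF assms(1) Suc.prems(2)] simple_factor_iff by blast
  then show ?case
    using Suc by (metis Suc_lessD less_antisym psubset_trans)
qed simp

text \<open>
  An element that kills the module kills all of its factors.
\<close>

lemma jh_multiplicity_eq_0:
  assumes "\<exists>Ns. composition_series R M Ns" "a \<in> carrier R"
    and "\<And>x. x \<in> carrier M \<Longrightarrow> a \<odot> x = \<zero>" and "acts_nonconstantly T a"
  shows "jh_multiplicity R M T = 0"
proof (rule jh_multiplicity_eqI)
  fix Ns assume Ns: "composition_series R M Ns"
  have "\<not> module_iso R (series_factor M Ns i) T" if "Suc i < length Ns" for i
    unfolding series_factor_def
    using composition_series_submodules(1-3)[OF Ns that] assms(2-4) submoduleD(1)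
    by (intro factor_not_iso) auto
  then show "card {i. Suc i < length Ns \<and> module_iso R (series_factor M Ns i) T} = 0"
    by (metis (mono_tags, lifting) card.empty empty_Collect_eq)
qed fact

end

section \<open>Modules with a head\<close>

text \<open>
  The element \<open>c\<close> models the identity of an object of the category. By \<open>c_absorb\<close> the elements
  killed by \<open>c\<close> are a submodule, by \<open>generates\<close> it contains every proper submodule.
\<close>

locale headed_module = left_module +
  fixes c
  assumes c_closed [simp]: "c \<in> carrier R"
    and c_absorb: "\<lbrakk>a \<in> carrier R; x \<in> carrier M\<rbrakk> \<Longrightarrow> c \<odot> (a \<odot> x) = c \<odot> (a \<odot> (c \<odot> x))"
    and generates: "\<lbrakk>submodule U R M; x \<in> U; c \<odot> x \<noteq> \<zero>\<rbrakk> \<Longrightarrow> U = carrier M"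
    and nonzero: "\<exists>x\<in>carrier M. c \<odot> x \<noteq> \<zero>"
begin

definition "rad = {x \<in> carrier M. c \<odot> x = \<zero>}"

lemma submodule_rad: "submodule rad R M"
  by (rule submoduleI) (auto simp: rad_def smult_r_distr c_absorb)

lemma c_idem: "x \<in> carrier M \<Longrightarrow> c \<odot> (c \<odot> x) = c \<odot> x"
  using c_absorb[of "\<one>\<^bsub>R\<^esub>" x] by simp

lemma proper_submodule_le_rad:
  assumes "submodule U R M" "U \<noteq> carrier M"
  shows "U \<subseteq> rad"
  using generates[OF assms(1)] assms(2) submoduleD(1)[OF assms(1)] by (auto simp: rad_def)

lemma rad_proper: "rad \<noteq> carrier M"
  using nonzero by (auto simp: rad_def)

lemma maximal_iff_rad: "maximal_submodule R M U \<longleftrightarrow> U = rad"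
  unfolding maximal_submodule_def
  using submodule_rad rad_proper proper_submodule_le_rad by blast

lemma module_radical_eq: "module_radical R M = rad"
  using submoduleD(1)[OF submodule_rad] by (simp add: module_radical_def maximal_iff_rad Int_absorb1)

lemma top_coset_eq_iff:
  assumes "x \<in> carrier M" "y \<in> carrier M"
  shows "rad +> x = rad +> y \<longleftrightarrow> c \<odot> x = c \<odot> y"
proof -
  have "rad +> x = rad +> y \<longleftrightarrow> c \<odot> (x \<oplus> \<ominus> y) = \<zero>"
    unfolding coset_eq_iff[OF submodule_rad assms] using assms by (simp add: rad_def)
  also have "c \<odot> (x \<oplus> \<ominus> y) = c \<odot> x \<oplus> \<ominus> (c \<odot> y)"
    using assms by (simp add: smult_r_distr smult_r_minus)
  also have "\<dots> = \<zero> \<longleftrightarrow> c \<odot> x = c \<odot> y"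
  proof
    assume "c \<odot> x \<oplus> \<ominus> (c \<odot> y) = \<zero>"
    then have "\<ominus> (\<ominus> (c \<odot> y)) = c \<odot> x"
      using assms by (intro M.minus_equality) auto
    then show "c \<odot> x = c \<odot> y"
      using assms by simp
  qed (use assms in \<open>simp add: M.r_neg\<close>)
  finally show ?thesis .
qed

lemma acts_on_top_iff:
  assumes "a \<in> carrier R"
  shows "acts_nonconstantly (quotient_module M rad) a \<longleftrightarrow>
    (\<exists>x\<in>carrier M. \<exists>y\<in>carrier M. c \<odot> (a \<odot> x) \<noteq> c \<odot> (a \<odot> y))"
  using assms by (simp add: acts_nonconstantly_def quotient_simps[OF submodule_rad]
      quotient_smult[OF submodule_rad] top_coset_eq_iff)

lemma acts_on_top: "acts_nonconstantly (quotient_module M rad) c"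
proof -
  obtain x where "x \<in> carrier M" "c \<odot> x \<noteq> \<zero>"
    using nonzero by blast
  then show ?thesis
    unfolding acts_on_top_iff[OF c_closed]
    by (intro bexI[of _ x] bexI[of _ \<zero>]) (auto simp: c_idem)
qed

text \<open>
  All terms of a composition series but the last are proper submodules, hence lie in \<open>rad\<close>, and
  \<open>c\<close> acts constantly on the factors that they form. The last factor is the quotient by a maximal
  submodule, which can only be \<open>rad\<close>.
\<close>

theorem jh_multiplicity_top:
  assumes "\<exists>Ns. composition_series R M Ns" and T: "acts_nonconstantly X c"
  shows "jh_multiplicity R M X = (if module_iso R (quotient_module M rad) X then 1 else 0)"
proof (rule jh_multiplicity_eqI)
  fix Ns assume Ns: "composition_series R M Ns"
  let ?F = "\<lambda>i. quotient_module (M\<lparr>carrier := Ns ! Suc i\<rparr>) (Ns ! i)"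
  have last: "Ns \<noteq> []" "Ns ! (length Ns - 1) = carrier M" "hd Ns = {\<zero>}"
    using Ns by (auto simp: composition_series_def last_conv_nth)
  have "length Ns \<noteq> 1"
  proof
    assume "length Ns = 1"
    then have "carrier M = {\<zero>}"
      using last by (metis One_nat_def diff_Suc_1 hd_conv_nth)
    then show False
      using nonzero by auto
  qed
  then obtain l where l: "length Ns = Suc (Suc l)"
    using last(1) by (metis One_nat_def Suc_pred length_greater_0_conv not0_implies_Suc)
  have top: "Ns ! Suc l = carrier M"
    using last l by simp
  have not: "\<not> module_iso R (?F i) X" if "i < l" for i
  proof -
    have i: "Suc i < length Ns"
      using that l by simp
    note F = composition_series_submodules(1-3)[OF Ns i]
    have "Ns ! Suc i \<noteq> carrier M"
      using composition_series_strict[OF Ns, of "Suc i" "Suc l"] that l top by auto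
    then have "Ns ! Suc i \<subseteq> rad"
      using F proper_submodule_le_rad by blast
    then show ?thesis
      using F T by (intro factor_not_iso) (auto simp: rad_def)
  qed
  have "Ns ! l = rad"
  proof -
    note F = composition_series_submodules[OF Ns, of l, unfolded l top, simplified]
    show ?thesis
      using F(4) simple_quotient_iff[OF F(1)] maximal_iff_rad by simp
  qed
  then have Fl: "?F l = (quotient_module M rad)"
    using top by simp
  have "{i. Suc i < length Ns \<and> module_iso R (series_factor M Ns i) X} =
      (if module_iso R (quotient_module M rad) X then {l} else {})"
    using not Fl l by (auto simp: series_factor_def less_Suc_eq)
  then show "card {i. Suc i < length Ns \<and> module_iso R (series_factor M Ns i) X} =
      (if module_iso R (quotient_module M rad) X then 1 else 0)"
    by simp
qed fact

end

section \<open>Left ideals\<close>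

lemma left_ideal_simps [simp]:
  "carrier (left_ideal_module R e) = (\<lambda>x. x \<otimes>\<^bsub>R\<^esub> e) ` carrier R"
  "zero (left_ideal_module R e) = \<zero>\<^bsub>R\<^esub>"
  "add (left_ideal_module R e) = add R"
  "smult (left_ideal_module R e) = monoid.mult R"
  by (auto simp: left_ideal_module_def)

lemma (in ring) left_ideal_left_module:
  assumes e: "e \<in> carrier R"
  shows "left_module R (left_ideal_module R e)"
proof -
  have "abelian_group (left_ideal_module R e)"
  proof (rule abelian_groupI)
    fix x y assume "x \<in> carrier (left_ideal_module R e)" "y \<in> carrier (left_ideal_module R e)"
    then obtain a b where "a \<in> carrier R" "b \<in> carrier R" "x = a \<otimes> e" "y = b \<otimes> e" by auto
    then show "x \<oplus>\<^bsub>left_ideal_module R e\<^esub> y \<in> carrier (left_ideal_module R e)"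
      using e by (auto simp: l_distr intro!: image_eqI[of _ _ "a \<oplus> b"])
  next
    show "\<zero>\<^bsub>left_ideal_module R e\<^esub> \<in> carrier (left_ideal_module R e)"
      using e by (auto intro!: image_eqI[of _ _ \<zero>])
  next
    fix x assume "x \<in> carrier (left_ideal_module R e)"
    then obtain a where a: "a \<in> carrier R" "x = a \<otimes> e" by auto
    then have "(\<ominus> a) \<otimes> e \<oplus> x = \<zero>"
      using e by (simp add: l_minus l_neg)
    then show "\<exists>y\<in>carrier (left_ideal_module R e).
        y \<oplus>\<^bsub>left_ideal_module R e\<^esub> x = \<zero>\<^bsub>left_ideal_module R e\<^esub>"
      using a by auto
  qed (use e in \<open>auto simp: a_ac\<close>)
  then show ?thesis
  proof (intro left_module.intro left_module_axioms.intro)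
    fix a x assume "a \<in> carrier R" "x \<in> carrier (left_ideal_module R e)"
    then obtain b where "b \<in> carrier R" "x = b \<otimes> e" by auto
    then show "a \<odot>\<^bsub>left_ideal_module R e\<^esub> x \<in> carrier (left_ideal_module R e)"
      using e \<open>a \<in> carrier R\<close> by (auto simp: m_assoc intro!: image_eqI[of _ _ "a \<otimes> b"])
  qed (use e in \<open>auto simp: ring_axioms l_distr r_distr m_assoc\<close>)
qed

section \<open>Epimorphisms between initial segments\<close>

abbreviation src :: "se_mor \<Rightarrow> nat" where "src m \<equiv> fst m"
abbreviation tgt :: "se_mor \<Rightarrow> nat" where "tgt m \<equiv> fst (snd m)"

lemma SE_hom_iff:
  "m \<in> SE_hom r k \<longleftrightarrow> src m = r \<and> tgt m = k \<and> snd (snd m) \<in> extensional {1..r} \<and>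
     snd (snd m) ` {1..r} = {1..k}"
  by (cases m) (auto simp: SE_hom_def)

lemma SE_mors_iff: "m \<in> SE_mors Ob \<longleftrightarrow> src m \<in> Ob \<and> tgt m \<in> Ob \<and> m \<in> SE_hom (src m) (tgt m)"
  by (auto simp: SE_mors_def SE_hom_iff)

lemma finite_SE_hom: "finite (SE_hom r k)"
proof -
  have "SE_hom r k \<subseteq> (\<lambda>f. (r, k, f)) ` ({1..r} \<rightarrow>\<^sub>E {1..k})"
    by (auto simp: SE_hom_def PiE_def)
  then show ?thesis
    by (rule finite_subset) (auto intro: finite_PiE)
qed

lemma finite_SE_mors: "finite Ob \<Longrightarrow> finite (SE_mors Ob)"
  by (simp add: SE_mors_def finite_SE_hom)

lemma SE_hom_le: "m \<in> SE_hom r k \<Longrightarrow> k \<le> r"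
  using card_image_le[of "{1..r}" "snd (snd m)"] by (auto simp: SE_hom_iff)

lemma SE_comp_simps [simp]: "src (SE_comp p q) = src q" "tgt (SE_comp p q) = tgt p"
  by (auto simp: SE_comp_def)

lemma SE_comp_hom: "p \<in> SE_hom k l \<Longrightarrow> q \<in> SE_hom r k \<Longrightarrow> SE_comp p q \<in> SE_hom r l"
  using surj_compose[of "snd (snd q)" "{1..r}" "{1..k}" "snd (snd p)" "{1..l}"]
  by (simp add: SE_hom_iff SE_comp_def)

lemma SE_comp_mors:
  "p \<in> SE_mors Ob \<Longrightarrow> q \<in> SE_mors Ob \<Longrightarrow> SE_composable p q \<Longrightarrow> SE_comp p q \<in> SE_mors Ob"
  using SE_comp_hom[of p "tgt q" "tgt p" q "src q"] by (simp add: SE_mors_iff SE_composable_def)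

lemma SE_composable_comp [simp]:
  "SE_composable (SE_comp p q) r \<longleftrightarrow> SE_composable q r"
  "SE_composable r (SE_comp p q) \<longleftrightarrow> SE_composable r p"
  by (auto simp: SE_composable_def)

lemma SE_comp_assoc:
  assumes "r \<in> SE_mors Ob" "SE_composable q r"
  shows "SE_comp (SE_comp p q) r = SE_comp p (SE_comp q r)"
proof -
  have "snd (snd r) \<in> {1..src r} \<rightarrow> {1..src q}"
    using assms by (auto simp: SE_mors_iff SE_hom_iff SE_composable_def)
  from compose_assoc[OF this, of "snd (snd p)" "snd (snd q)"] show ?thesis
    by (simp add: SE_comp_def)
qed

lemma SE_id_hom: "SE_id k \<in> SE_hom k k"
  by (auto simp: SE_id_def SE_hom_def image_iff)

lemma SE_id_simps [simp]: "src (SE_id k) = k" "tgt (SE_id k) = k" "SE_id k = SE_id l \<longleftrightarrow> k = l"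
  by (auto simp: SE_id_def)

lemma SE_comp_id_left: "q \<in> SE_hom r k \<Longrightarrow> SE_comp (SE_id k) q = q"
  by (cases q) (auto simp: SE_hom_def SE_comp_def SE_id_def compose_def extensional_def fun_eq_iff)

lemma SE_comp_id_right: "q \<in> SE_hom r k \<Longrightarrow> SE_comp q (SE_id r) = q"
  by (cases q) (auto simp: SE_hom_def SE_comp_def SE_id_def compose_def extensional_def fun_eq_iff)

section \<open>The category algebra\<close>

text \<open>
  The structure constants of the algebra in the basis of morphisms. They turn the product into
  an unrestricted double sum, in which sums can be exchanged.
\<close>

definition struct_const :: "se_mor \<Rightarrow> se_mor \<Rightarrow> se_mor \<Rightarrow> complex" where
  "struct_const p q m = (if SE_composable p q \<and> SE_comp p q = m then 1 else 0)"

lemma SE_algebra_simps [simp]: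
  "x \<in> carrier (SE_algebra Ob) \<longleftrightarrow> (\<forall>m. m \<notin> SE_mors Ob \<longrightarrow> x m = 0)"
  "\<zero>\<^bsub>SE_algebra Ob\<^esub> = (\<lambda>m. 0)"
  "x \<oplus>\<^bsub>SE_algebra Ob\<^esub> y = (\<lambda>m. x m + y m)"
  "\<one>\<^bsub>SE_algebra Ob\<^esub> = (\<lambda>m. if m \<in> SE_id ` Ob then 1 else 0)"
  by (simp_all add: SE_algebra_def)

lemma SE_outside: "x \<in> carrier (SE_algebra Ob) \<Longrightarrow> m \<notin> SE_mors Ob \<Longrightarrow> x m = 0"
  unfolding SE_algebra_simps by blast

lemma SE_mult:
  assumes "finite Ob"
  shows "(x \<otimes>\<^bsub>SE_algebra Ob\<^esub> y) m =
    (\<Sum>p\<in>SE_mors Ob. \<Sum>q\<in>SE_mors Ob. x p * y q * struct_const p q m)"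
proof -
  let ?X = "SE_mors Ob"
  have "(x \<otimes>\<^bsub>SE_algebra Ob\<^esub> y) m =
      (\<Sum>(p, q) \<in> {(p, q) \<in> ?X \<times> ?X. SE_composable p q \<and> SE_comp p q = m}. x p * y q)"
    by (auto simp: SE_algebra_def intro!: sum.cong)
  also have "\<dots> = (\<Sum>(p, q) \<in> ?X \<times> ?X. x p * y q * struct_const p q m)"
    using finite_SE_mors[OF assms]
    by (intro sum.mono_neutral_cong_left) (auto simp: struct_const_def split: if_splits)
  also have "\<dots> = (\<Sum>p\<in>?X. \<Sum>q\<in>?X. x p * y q * struct_const p q m)"
    by (simp add: sum.cartesian_product)
  finally show ?thesis .
qed

lemma struct_const_assoc:
  assumes "finite Ob" "p \<in> SE_mors Ob" "q \<in> SE_mors Ob" "s \<in> SE_mors Ob"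
  shows "(\<Sum>r\<in>SE_mors Ob. struct_const p q r * struct_const r s m) = (\<Sum>r\<in>SE_mors Ob. struct_const q s r * struct_const p r m)"
proof -
  have "(\<Sum>r\<in>SE_mors Ob. struct_const p q r * struct_const r s m) =
      (\<Sum>r\<in>SE_mors Ob. if r = SE_comp p q then (if SE_composable p q then struct_const r s m else 0) else 0)"
    by (intro sum.cong) (auto simp: struct_const_def)
  also have "\<dots> = (if SE_composable p q then struct_const (SE_comp p q) s m else 0)"
    using assms finite_SE_mors[of Ob] SE_comp_mors[of p Ob q] by (simp add: sum.delta)
  also have "\<dots> = (if SE_composable q s then struct_const p (SE_comp q s) m else 0)"
    using SE_comp_assoc[OF assms(4), of q p] by (auto simp: struct_const_def)
  also have "\<dots> =
      (\<Sum>r\<in>SE_mors Ob. if r = SE_comp q s then (if SE_composable q s then struct_const p r m else 0) else 0)"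
    using assms finite_SE_mors[of Ob] SE_comp_mors[of q Ob s] by (simp add: sum.delta)
  also have "\<dots> = (\<Sum>r\<in>SE_mors Ob. struct_const q s r * struct_const p r m)"
    by (intro sum.cong) (auto simp: struct_const_def)
  finally show ?thesis .
qed

lemma sum_rotate:
  "(\<Sum>r\<in>A. \<Sum>q\<in>B. \<Sum>s\<in>C. f r q s) = (\<Sum>q\<in>B. \<Sum>s\<in>C. \<Sum>r\<in>A. f r q s)"
proof -
  have "(\<Sum>r\<in>A. \<Sum>q\<in>B. \<Sum>s\<in>C. f r q s) = (\<Sum>q\<in>B. \<Sum>r\<in>A. \<Sum>s\<in>C. f r q s)"
    by (rule sum.swap)
  also have "\<dots> = (\<Sum>q\<in>B. \<Sum>s\<in>C. \<Sum>r\<in>A. f r q s)"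
    by (rule sum.cong[OF refl], rule sum.swap)
  finally show ?thesis .
qed

lemma SE_mult_assoc:
  assumes "finite Ob"
  shows "(x \<otimes>\<^bsub>SE_algebra Ob\<^esub> y) \<otimes>\<^bsub>SE_algebra Ob\<^esub> z =
    x \<otimes>\<^bsub>SE_algebra Ob\<^esub> (y \<otimes>\<^bsub>SE_algebra Ob\<^esub> z)"
proof
  fix m
  let ?X = "SE_mors Ob"
  have "((x \<otimes>\<^bsub>SE_algebra Ob\<^esub> y) \<otimes>\<^bsub>SE_algebra Ob\<^esub> z) m =
      (\<Sum>r\<in>?X. \<Sum>s\<in>?X. \<Sum>p\<in>?X. \<Sum>q\<in>?X. x p * y q * z s * (struct_const p q r * struct_const r s m))"
    by (simp add: SE_mult[OF assms] sum_distrib_left sum_distrib_right mult_ac)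
  also have "\<dots> = (\<Sum>r\<in>?X. \<Sum>p\<in>?X. \<Sum>q\<in>?X. \<Sum>s\<in>?X. x p * y q * z s * (struct_const p q r * struct_const r s m))"
    by (rule sum.cong[OF refl], rule sum_rotate)
  also have "\<dots> = (\<Sum>p\<in>?X. \<Sum>q\<in>?X. \<Sum>r\<in>?X. \<Sum>s\<in>?X. x p * y q * z s * (struct_const p q r * struct_const r s m))"
    by (rule sum_rotate)
  also have "\<dots> = (\<Sum>p\<in>?X. \<Sum>q\<in>?X. \<Sum>s\<in>?X. \<Sum>r\<in>?X. x p * y q * z s * (struct_const p q r * struct_const r s m))"
    by (rule sum.cong[OF refl], rule sum.cong[OF refl], rule sum.swap)
  also have "\<dots> = (\<Sum>p\<in>?X. \<Sum>q\<in>?X. \<Sum>s\<in>?X. \<Sum>r\<in>?X. x p * y q * z s * (struct_const q s r * struct_const p r m))"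
    unfolding sum_distrib_left[symmetric] using struct_const_assoc[OF assms] by simp
  also have "\<dots> = (\<Sum>p\<in>?X. \<Sum>r\<in>?X. \<Sum>q\<in>?X. \<Sum>s\<in>?X. x p * y q * z s * (struct_const q s r * struct_const p r m))"
    by (rule sum.cong[OF refl], rule sum_rotate[symmetric])
  also have "\<dots> = (x \<otimes>\<^bsub>SE_algebra Ob\<^esub> (y \<otimes>\<^bsub>SE_algebra Ob\<^esub> z)) m"
    by (simp add: SE_mult[OF assms] sum_distrib_left sum_distrib_right mult_ac)
  finally show "((x \<otimes>\<^bsub>SE_algebra Ob\<^esub> y) \<otimes>\<^bsub>SE_algebra Ob\<^esub> z) m =
    (x \<otimes>\<^bsub>SE_algebra Ob\<^esub> (y \<otimes>\<^bsub>SE_algebra Ob\<^esub> z)) m" .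
qed

lemma SE_mult_support:
  assumes "finite Ob" "(x \<otimes>\<^bsub>SE_algebra Ob\<^esub> y) m \<noteq> 0"
  obtains p q where "p \<in> SE_mors Ob" "q \<in> SE_mors Ob" "x p \<noteq> 0" "y q \<noteq> 0"
    "SE_composable p q" "m = SE_comp p q"
proof -
  obtain p where p: "p \<in> SE_mors Ob" "(\<Sum>q\<in>SE_mors Ob. x p * y q * struct_const p q m) \<noteq> 0"
    using assms(2) unfolding SE_mult[OF assms(1)] by (rule sum.not_neutral_contains_not_neutral)
  obtain q where "q \<in> SE_mors Ob" "x p * y q * struct_const p q m \<noteq> 0"
    using p(2) by (rule sum.not_neutral_contains_not_neutral)
  then show ?thesis
    using p(1) by (intro that[of p q]) (auto simp: struct_const_def split: if_splits)
qed

lemma SE_mult_closed: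
  assumes "finite Ob"
  shows "x \<otimes>\<^bsub>SE_algebra Ob\<^esub> y \<in> carrier (SE_algebra Ob)"
  using SE_mult_support[OF assms] SE_comp_mors by (metis SE_algebra_simps(1))

text \<open>
  The sum of the identities of the objects in \<open>L\<close>. Multiplying by it from the left selects
  the morphisms with target in \<open>L\<close>, from the right those with source in \<open>L\<close>.
\<close>

definition obj_id :: "nat set \<Rightarrow> se_mor \<Rightarrow> complex" where
  "obj_id L m = (if m \<in> SE_id ` L then 1 else 0)"

lemma obj_id_SE_id [simp]: "obj_id L (SE_id k) = (if k \<in> L then 1 else 0)"
  by (auto simp: obj_id_def)

lemma obj_id_struct_const_left:
  assumes "q \<in> SE_hom r k"
  shows "obj_id L p * struct_const p q m = (if p = SE_id k then (if q = m \<and> k \<in> L then 1 else 0) else 0)"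
proof (cases "p \<in> range SE_id")
  case True
  then obtain l where "p = SE_id l" by blast
  moreover have "tgt q = k"
    using assms by (simp add: SE_hom_iff)
  ultimately show ?thesis
    using SE_comp_id_left[OF assms] by (simp add: struct_const_def SE_composable_def)
qed (auto simp: obj_id_def)

lemma obj_id_struct_const_right:
  assumes "p \<in> SE_hom r k"
  shows "obj_id L q * struct_const p q m = (if q = SE_id r then (if p = m \<and> r \<in> L then 1 else 0) else 0)"
proof (cases "q \<in> range SE_id")
  case True
  then obtain l where "q = SE_id l" by blast
  moreover have "src p = r"
    using assms by (simp add: SE_hom_iff)
  ultimately show ?thesis
    using SE_comp_id_right[OF assms] by (auto simp: struct_const_def SE_composable_def)
qed (auto simp: obj_id_def)

lemma SE_one: "\<one>\<^bsub>SE_algebra Ob\<^esub> = obj_id Ob"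
  by (auto simp: obj_id_def)

lemma SE_id_mors: "l \<in> Ob \<Longrightarrow> SE_id l \<in> SE_mors Ob"
  using SE_id_hom by (simp add: SE_mors_iff)

lemma obj_id_closed: "L \<subseteq> Ob \<Longrightarrow> obj_id L \<in> carrier (SE_algebra Ob)"
  using SE_id_mors by (auto simp: obj_id_def)

lemma obj_id_mult:
  assumes "finite Ob" "y \<in> carrier (SE_algebra Ob)"
  shows "obj_id L \<otimes>\<^bsub>SE_algebra Ob\<^esub> y = (\<lambda>m. if tgt m \<in> L then y m else 0)"
proof
  fix m
  let ?X = "SE_mors Ob"
  have fin: "finite ?X"
    using assms(1) by (rule finite_SE_mors)
  have "(\<Sum>p\<in>?X. obj_id L p * y q * struct_const p q m) = (if q = m then (if tgt m \<in> L then y m else 0) else 0)"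
    if q: "q \<in> ?X" for q
  proof -
    have hom: "q \<in> SE_hom (src q) (tgt q)" "tgt q \<in> Ob"
      using q unfolding SE_mors_iff by blast+
    have "obj_id L p * y q * struct_const p q m =
        (if p = SE_id (tgt q) then (if q = m \<and> tgt q \<in> L then y q else 0) else 0)" for p
      by (simp only: mult.commute[of "obj_id L p"] mult.assoc obj_id_struct_const_left[OF hom(1)]) auto
    then show ?thesis
      using SE_id_mors[OF hom(2)] fin by (simp add: sum.delta)
  qed
  then have "(\<Sum>q\<in>?X. \<Sum>p\<in>?X. obj_id L p * y q * struct_const p q m) =
      (\<Sum>q\<in>?X. if q = m then (if tgt m \<in> L then y m else 0) else 0)"
    by (rule sum.cong[OF refl])
  also have "\<dots> = (if tgt m \<in> L then y m else 0)"
    using SE_outside[OF assms(2)] fin by (simp add: sum.delta)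
  finally show "(obj_id L \<otimes>\<^bsub>SE_algebra Ob\<^esub> y) m = (if tgt m \<in> L then y m else 0)"
    unfolding SE_mult[OF assms(1)] by (subst sum.swap)
qed

lemma mult_obj_id:
  assumes "finite Ob" "y \<in> carrier (SE_algebra Ob)"
  shows "y \<otimes>\<^bsub>SE_algebra Ob\<^esub> obj_id L = (\<lambda>m. if src m \<in> L then y m else 0)"
proof
  fix m
  let ?X = "SE_mors Ob"
  have fin: "finite ?X"
    using assms(1) by (rule finite_SE_mors)
  have "(\<Sum>q\<in>?X. y p * obj_id L q * struct_const p q m) = (if p = m then (if src m \<in> L then y m else 0) else 0)"
    if p: "p \<in> ?X" for p
  proof -
    have hom: "p \<in> SE_hom (src p) (tgt p)" "src p \<in> Ob"
      using p unfolding SE_mors_iff by blast+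
    have "y p * obj_id L q * struct_const p q m =
        (if q = SE_id (src p) then (if p = m \<and> src p \<in> L then y p else 0) else 0)" for q
      by (simp only: mult.assoc obj_id_struct_const_right[OF hom(1)]) auto
    then show ?thesis
      using SE_id_mors[OF hom(2)] fin by (simp add: sum.delta)
  qed
  then have "(\<Sum>p\<in>?X. \<Sum>q\<in>?X. y p * obj_id L q * struct_const p q m) =
      (\<Sum>p\<in>?X. if p = m then (if src m \<in> L then y m else 0) else 0)"
    by (rule sum.cong[OF refl])
  also have "\<dots> = (if src m \<in> L then y m else 0)"
    using SE_outside[OF assms(2)] fin by (simp add: sum.delta)
  finally show "(y \<otimes>\<^bsub>SE_algebra Ob\<^esub> obj_id L) m = (if src m \<in> L then y m else 0)"
    unfolding SE_mult[OF assms(1)] .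
qed

lemma ring_SE_algebra:
  assumes "finite Ob"
  shows "ring (SE_algebra Ob)"
proof (rule ringI)
  show "abelian_group (SE_algebra Ob)"
  proof (rule abelian_groupI)
    fix x assume "x \<in> carrier (SE_algebra Ob)"
    then show "\<exists>y\<in>carrier (SE_algebra Ob). y \<oplus>\<^bsub>SE_algebra Ob\<^esub> x = \<zero>\<^bsub>SE_algebra Ob\<^esub>"
      by (intro bexI[of _ "\<lambda>m. - x m"]) auto
  qed (auto simp: add_ac)
  show "monoid (SE_algebra Ob)"
  proof (rule monoidI)
    fix x assume x: "x \<in> carrier (SE_algebra Ob)"
    have outside: "x m = 0" if "src m \<notin> Ob \<or> tgt m \<notin> Ob" for m
      using SE_outside[OF x, of m] that unfolding SE_mors_iff by blast
    show "\<one>\<^bsub>SE_algebra Ob\<^esub> \<otimes>\<^bsub>SE_algebra Ob\<^esub> x = x"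
      unfolding SE_one obj_id_mult[OF assms x] using outside by (intro ext) simp
    show "x \<otimes>\<^bsub>SE_algebra Ob\<^esub> \<one>\<^bsub>SE_algebra Ob\<^esub> = x"
      unfolding SE_one mult_obj_id[OF assms x] using outside by (intro ext) simp
  next
    show "\<one>\<^bsub>SE_algebra Ob\<^esub> \<in> carrier (SE_algebra Ob)"
      unfolding SE_one by (rule obj_id_closed) simp
  qed (rule SE_mult_closed[OF assms] SE_mult_assoc[OF assms])+
qed (auto simp: SE_mult[OF assms] fun_eq_iff distrib_left distrib_right sum.distrib)

lemma SE_mult_subset:
  assumes "finite Ob" "Ob' \<subseteq> Ob" "x \<in> carrier (SE_algebra Ob')" "y \<in> carrier (SE_algebra Ob')"
  shows "x \<otimes>\<^bsub>SE_algebra Ob'\<^esub> y = x \<otimes>\<^bsub>SE_algebra Ob\<^esub> y"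
proof
  fix m
  have sub: "SE_mors Ob' \<subseteq> SE_mors Ob"
    using assms(2) by (auto simp: SE_mors_iff)
  have "(\<Sum>q\<in>SE_mors Ob'. x p * y q * struct_const p q m) = (\<Sum>q\<in>SE_mors Ob. x p * y q * struct_const p q m)" for p
    using assms(4) sub finite_SE_mors[OF assms(1)] by (intro sum.mono_neutral_left) auto
  then have "(\<Sum>p\<in>SE_mors Ob'. \<Sum>q\<in>SE_mors Ob'. x p * y q * struct_const p q m) =
      (\<Sum>p\<in>SE_mors Ob. \<Sum>q\<in>SE_mors Ob. x p * y q * struct_const p q m)"
    using assms(3) sub finite_SE_mors[OF assms(1)] by (simp, intro sum.mono_neutral_left) auto
  then show "(x \<otimes>\<^bsub>SE_algebra Ob'\<^esub> y) m = (x \<otimes>\<^bsub>SE_algebra Ob\<^esub> y) m"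
    using assms(1,2) by (simp add: SE_mult finite_subset)
qed

lemma carrier_SE_mono: "Ob' \<subseteq> Ob \<Longrightarrow> carrier (SE_algebra Ob') \<subseteq> carrier (SE_algebra Ob)"
  by (force simp: SE_mors_iff)

lemma SE_scale_mult:
  assumes "finite Ob"
  shows "(\<lambda>m. c * x m) \<otimes>\<^bsub>SE_algebra Ob\<^esub> y = (\<lambda>m. c * (x \<otimes>\<^bsub>SE_algebra Ob\<^esub> y) m)"
  by (simp add: fun_eq_iff SE_mult[OF assms] sum_distrib_left mult_ac)

section \<open>Finite dimension\<close>

interpretation fn: vector_space "\<lambda>c (f :: 'a \<Rightarrow> complex) x. c * f x"
  by unfold_locales (auto simp: fun_eq_iff algebra_simps)

lemma supported_in_span:
  fixes f :: "'a \<Rightarrow> complex"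
  assumes "finite X" "\<And>x. x \<notin> X \<Longrightarrow> f x = 0"
  shows "f \<in> fn.span ((\<lambda>x y. if y = x then 1 else 0) ` X)"
proof -
  have "f = (\<Sum>x\<in>X. (\<lambda>y. f x * (if y = x then 1 else 0)))"
  proof
    fix y
    have "(\<Sum>x\<in>X. (\<lambda>y. f x * (if y = x then 1 else 0))) y = (\<Sum>x\<in>X. f x * (if y = x then 1 else 0))"
      by (induction X rule: infinite_finite_induct) auto
    also have "\<dots> = f y"
      using assms by (auto simp: sum.delta if_distrib cong: if_cong)
    finally show "f y = (\<Sum>x\<in>X. (\<lambda>y. f x * (if y = x then 1 else 0))) y" by simp
  qed
  also have "\<dots> \<in> fn.span ((\<lambda>x y. if y = x then 1 else 0) ` X)"
    by (intro fn.span_sum fn.span_scale fn.span_base) auto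
  finally show ?thesis .
qed

lemma supported_finite_basis:
  fixes U :: "('a \<Rightarrow> complex) set"
  assumes "finite X" "\<And>f x. f \<in> U \<Longrightarrow> x \<notin> X \<Longrightarrow> f x = 0"
  obtains B where "B \<subseteq> U" "finite B" "fn.independent B" "U \<subseteq> fn.span B"
proof -
  obtain B where B: "B \<subseteq> U" "fn.independent B" "U \<subseteq> fn.span B"
    using fn.maximal_independent_subset[of U] by blast
  let ?D = "(\<lambda>x y. if y = x then 1 else (0::complex)) ` X"
  have "B \<subseteq> fn.span ?D"
    using supported_in_span[OF assms(1)] assms(2) B(1) by blast
  then have "finite B"
    using fn.independent_span_bound[of ?D B] B(2) assms(1) by auto
  then show ?thesis
    using that B by blast
qed

text \<open>
  A basis of \<open>U\<close> together with one vector outside of \<open>U\<close> is still independent.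
\<close>

lemma dim_strict_mono:
  fixes U V :: "('a \<Rightarrow> complex) set"
  assumes "finite X" "\<And>f x. f \<in> V \<Longrightarrow> x \<notin> X \<Longrightarrow> f x = 0"
    and "fn.subspace U" "U \<subset> V"
  shows "fn.dim U < fn.dim V"
proof -
  obtain B where B: "B \<subseteq> U" "finite B" "fn.independent B" "U \<subseteq> fn.span B"
    by (rule supported_finite_basis[OF assms(1), of U]) (use assms in auto)
  obtain v where v: "v \<in> V" "v \<notin> U"
    using assms(4) by blast
  have "v \<notin> fn.span B"
    using v fn.span_minimal[OF B(1) assms(3)] by blast
  then have ind: "fn.independent (insert v B)"
    using B by (simp add: fn.independent_insertI)
  obtain C where C: "C \<subseteq> V" "finite C" "fn.independent C" "V \<subseteq> fn.span C"
    by (rule supported_finite_basis[OF assms(1), of V]) (use assms(2) in auto)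
  have "insert v B \<subseteq> fn.span C"
    using v B C assms(4) by blast
  then have "card (insert v B) \<le> card C"
    using fn.independent_span_bound[OF C(2) ind] by blast
  moreover have "v \<notin> B"
    using v B by blast
  moreover have "card B = fn.dim U" "card C = fn.dim V"
    using B C fn.basis_card_eq_dim by blast+
  ultimately show ?thesis
    using B(2) by simp
qed

text \<open>
  The Gram-Schmidt process: if \<open>v\<close> is projected to the span of \<open>B\<close>, then the projection to the span of
  \<open>insert b B\<close> differs by a multiple of the component \<open>d\<close> of \<open>b\<close> orthogonal to the span of \<open>B\<close>.
\<close>

lemma orthogonal_projection:
  fixes v :: "'a \<Rightarrow> complex"
  assumes "finite X" and sub: "fn.subspace U" and "\<And>f x. f \<in> U \<Longrightarrow> x \<notin> X \<Longrightarrow> f x = 0"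
  obtains u where "u \<in> U" "\<And>w. w \<in> U \<Longrightarrow> (\<Sum>x\<in>X. w x * cnj (v x - u x)) = 0"
proof -
  have proj: "\<exists>u\<in>fn.span B. \<forall>w\<in>fn.span B. (\<Sum>x\<in>X. w x * cnj (v x - u x)) = 0"
    if "finite B" for B and v :: "'a \<Rightarrow> complex"
    using that
  proof (induction B arbitrary: v)
    case empty
    then show ?case by auto
  next
    case (insert b B)
    obtain b' where b': "b' \<in> fn.span B" "\<And>w. w \<in> fn.span B \<Longrightarrow> (\<Sum>x\<in>X. w x * cnj (b x - b' x)) = 0"
      using insert.IH[of b] by blast
    obtain u where u: "u \<in> fn.span B" "\<And>w. w \<in> fn.span B \<Longrightarrow> (\<Sum>x\<in>X. w x * cnj (v x - u x)) = 0"
      using insert.IH[of v] by blast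
    define d where "d = (\<lambda>x. b x - b' x)"
    \<comment> \<open>If \<open>d = 0\<close>, then \<open>b\<close> is already in the span of \<open>B\<close>, and division by \<open>N = 0\<close> gives \<open>c = 0\<close>.\<close>
    define N where "N = (\<Sum>x\<in>X. d x * cnj (d x))"
    define c where "c = (\<Sum>x\<in>X. v x * cnj (d x)) / N"
    have span: "fn.span (insert b B) = {x. \<exists>k. x - (\<lambda>y. k * b y) \<in> fn.span B}"
      by (rule fn.span_insert)
    have d_span: "d \<in> fn.span (insert b B)"
    proof -
      have "d - (\<lambda>y. 1 * b y) = (\<lambda>x. (-1) * b' x)"
        by (auto simp: d_def)
      moreover have "(\<lambda>x. (-1) * b' x) \<in> fn.span B"
        using b'(1) by (rule fn.span_scale)
      ultimately have "d - (\<lambda>y. 1 * b y) \<in> fn.span B"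
        by (simp only:)
      then show ?thesis
        unfolding span by (intro CollectI exI)
    qed
    let ?u = "u + (\<lambda>x. c * d x)"
    have "?u \<in> fn.span (insert b B)"
    proof (rule fn.span_add)
      show "u \<in> fn.span (insert b B)"
        using u(1) fn.span_mono[of B "insert b B"] by blast
    qed (rule fn.span_scale[OF d_span])
    moreover have "(\<Sum>x\<in>X. w x * cnj (v x - ?u x)) = 0" if wB: "w \<in> fn.span (insert b B)" for w
    proof -
      obtain k where k: "w - (\<lambda>y. k * b y) \<in> fn.span B"
        using wB unfolding span by blast
      define w' where "w' = (w - (\<lambda>y. k * b y)) + (\<lambda>x. k * b' x)"
      have w': "w' \<in> fn.span B"
        unfolding w'_def using k b'(1) by (intro fn.span_add fn.span_scale)
      have w: "w x = w' x + k * d x" for x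
        by (simp add: w'_def d_def algebra_simps)
      have 1: "(\<Sum>x\<in>X. w' x * cnj (v x - u x)) = 0" and 2: "(\<Sum>x\<in>X. w' x * cnj (d x)) = 0"
        and 3: "(\<Sum>x\<in>X. u x * cnj (d x)) = 0"
        using w' u b' by (auto simp: d_def)
      have "(\<Sum>x\<in>X. d x * cnj (v x - ?u x)) = 0"
      proof (cases "N = 0")
        case True
        have "N = (\<Sum>x\<in>X. of_real ((cmod (d x))\<^sup>2))"
          unfolding N_def by (simp only: complex_norm_square)
        then have "of_real (\<Sum>x\<in>X. (cmod (d x))\<^sup>2) = (0::complex)"
          using True by simp
        then have "(\<Sum>x\<in>X. (cmod (d x))\<^sup>2) = 0"
          using of_real_eq_0_iff by blast
        then have "\<forall>x\<in>X. d x = 0"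
          using assms(1) by (simp add: sum_nonneg_eq_0_iff)
        then show ?thesis by simp
      next
        case False
        have "(\<Sum>x\<in>X. (v x - ?u x) * cnj (d x)) =
            (\<Sum>x\<in>X. v x * cnj (d x)) - (\<Sum>x\<in>X. u x * cnj (d x)) - c * N"
        proof -
          have "(v x - ?u x) * cnj (d x) =
              v x * cnj (d x) - u x * cnj (d x) - c * (d x * cnj (d x))" for x
            by (simp add: algebra_simps)
          then show ?thesis by (simp only: N_def sum_subtractf sum_distrib_left)
        qed
        also have "\<dots> = 0"
          using False 3 by (simp add: c_def)
        finally have "cnj (\<Sum>x\<in>X. (v x - ?u x) * cnj (d x)) = 0" by simp
        then show ?thesis by (simp add: mult.commute)
      qed
      moreover have "(\<Sum>x\<in>X. w' x * cnj (v x - ?u x)) =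
          (\<Sum>x\<in>X. w' x * cnj (v x - u x)) - cnj c * (\<Sum>x\<in>X. w' x * cnj (d x))"
      proof -
        have "w' x * cnj (v x - ?u x) = w' x * cnj (v x - u x) - cnj c * (w' x * cnj (d x))" for x
          by (simp add: algebra_simps)
        then show ?thesis by (simp only: sum_subtractf sum_distrib_left)
      qed
      moreover have "(\<Sum>x\<in>X. w x * cnj (v x - ?u x)) =
          (\<Sum>x\<in>X. w' x * cnj (v x - ?u x)) + k * (\<Sum>x\<in>X. d x * cnj (v x - ?u x))"
        unfolding w by (simp only: distrib_right sum.distrib sum_distrib_left mult.assoc)
      ultimately show ?thesis
        using 1 2 by simp
    qed
    ultimately show ?case by blast
  qed
  obtain B where B: "B \<subseteq> U" "finite B" "U \<subseteq> fn.span B"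
    by (rule supported_finite_basis[OF assms(1), of U]) (use assms(3) in auto)
  have "fn.span B = U"
    using B sub by (simp add: fn.span_minimal subset_antisym)
  then obtain u where "u \<in> U" "\<forall>w\<in>U. (\<Sum>x\<in>X. w x * cnj (v x - u x)) = 0"
    using proj[OF B(2), of v] by auto
  with that show ?thesis by blast
qed

section \<open>Primitive idempotents of the group algebra\<close>

definition SE_inv :: "se_mor \<Rightarrow> se_mor" where
  "SE_inv p = (tgt p, src p, restrict (inv_into {1..src p} (snd (snd p))) {1..tgt p})"

lemma SE_inv_simps [simp]: "src (SE_inv p) = tgt p" "tgt (SE_inv p) = src p"
  by (simp_all add: SE_inv_def)

lemma SE_endo_bij:
  assumes "p \<in> SE_hom k k"
  shows "bij_betw (snd (snd p)) {1..k} {1..k}"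
  using assms unfolding bij_betw_def SE_hom_iff by (auto intro: eq_card_imp_inj_on)

lemma SE_inv_hom:
  assumes "p \<in> SE_hom k k"
  shows "SE_inv p \<in> SE_hom k k"
proof -
  have "inv_into {1..k} (snd (snd p)) ` {1..k} = {1..k}"
    using bij_betw_inv_into[OF SE_endo_bij[OF assms]] by (rule bij_betw_imp_surj_on)
  moreover have "src p = k" "tgt p = k"
    using assms by (simp_all add: SE_hom_iff)
  ultimately show ?thesis
    by (simp add: SE_hom_iff SE_inv_def image_restrict_eq)
qed

lemma SE_comp_inv:
  assumes "p \<in> SE_hom k k"
  shows "SE_comp p (SE_inv p) = SE_id k" "SE_comp (SE_inv p) p = SE_id k"
proof -
  obtain f where p: "p = (k, k, f)" "f ` {1..k} = {1..k}" 
    using assms by (cases p) (auto simp: SE_hom_def)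
  have inj: "inj_on f {1..k}"
    using SE_endo_bij[OF assms] p by (simp add: bij_betw_def)
  show "SE_comp p (SE_inv p) = SE_id k"
    using p f_inv_into_f[of _ f "{1..k}"]
    by (simp add: SE_comp_def SE_inv_def SE_id_def compose_def fun_eq_iff restrict_def)
  have "f x \<in> {1..k}" if "x \<in> {1..k}" for x
    using p(2) that by blast
  then show "SE_comp (SE_inv p) p = SE_id k"
    using p inv_into_f_f[OF inj]
    by (simp add: SE_comp_def SE_inv_def SE_id_def compose_def fun_eq_iff restrict_def)
qed

lemma SE_mors_single: "SE_mors {k} = SE_hom k k"
  by (simp add: SE_mors_def)

lemma SE_inv_inv:
  assumes "p \<in> SE_hom k k"
  shows "SE_inv (SE_inv p) = p"
proof -
  note p' = SE_inv_hom[OF assms] and p'' = SE_inv_hom[OF SE_inv_hom[OF assms]]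
  have "SE_inv (SE_inv p) = SE_comp (SE_comp p (SE_inv p)) (SE_inv (SE_inv p))"
    using SE_comp_inv(1)[OF assms] SE_comp_id_left[OF p''] by simp
  also have "\<dots> = SE_comp p (SE_comp (SE_inv p) (SE_inv (SE_inv p)))"
    using p'' p' by (intro SE_comp_assoc[of _ "{k}"]) (auto simp: SE_mors_single SE_composable_def SE_hom_iff)
  also have "\<dots> = p"
    using SE_comp_inv(1)[OF p'] SE_comp_id_right[OF assms] by simp
  finally show ?thesis .
qed

lemma struct_const_inv:
  assumes p: "p \<in> SE_hom k k" and q: "q \<in> SE_hom k k" and m: "m \<in> SE_hom k k"
  shows "struct_const (SE_inv p) m q = struct_const p q m"
proof -
  note p' = SE_inv_hom[OF p]
  have assoc: "SE_comp (SE_comp x y) z = SE_comp x (SE_comp y z)"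
    if "y \<in> SE_hom k k" "z \<in> SE_hom k k" for x y z
    using that by (intro SE_comp_assoc[of _ "{k}"]) (auto simp: SE_mors_single SE_composable_def SE_hom_iff)
  have "SE_comp (SE_inv p) m = q \<longleftrightarrow> SE_comp p q = m"
  proof
    assume "SE_comp (SE_inv p) m = q"
    then show "SE_comp p q = m"
      using assoc[OF p' m, of p] SE_comp_inv(1)[OF p] SE_comp_id_left[OF m] by simp
  next
    assume "SE_comp p q = m"
    then show "SE_comp (SE_inv p) m = q"
      using assoc[OF p q, of "SE_inv p"] SE_comp_inv(2)[OF p] SE_comp_id_left[OF q] by simp
  qed
  then show ?thesis
    using p q m by (simp add: struct_const_def SE_composable_def SE_hom_iff)
qed

text \<open>
  The conjugate linear anti-automorphism of the group algebra that inverts permutations.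
\<close>

definition adjoint :: "nat \<Rightarrow> (se_mor \<Rightarrow> complex) \<Rightarrow> se_mor \<Rightarrow> complex" where
  "adjoint k a p = (if p \<in> SE_hom k k then cnj (a (SE_inv p)) else 0)"

definition ip :: "nat \<Rightarrow> (se_mor \<Rightarrow> complex) \<Rightarrow> (se_mor \<Rightarrow> complex) \<Rightarrow> complex" where
  "ip k x y = (\<Sum>m\<in>SE_hom k k. x m * cnj (y m))"

text \<open>
  Left multiplication by a permutation is unitary for the standard inner product.
\<close>

lemma ip_adjoint: "ip k w (a \<otimes>\<^bsub>CS k\<^esub> g) = ip k (adjoint k a \<otimes>\<^bsub>CS k\<^esub> w) g"
proof -
  let ?X = "SE_hom k k"
  have mult: "(x \<otimes>\<^bsub>CS k\<^esub> y) m = (\<Sum>p\<in>?X. \<Sum>q\<in>?X. x p * y q * struct_const p q m)" for x y m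
    by (simp add: SE_mult SE_mors_single)
  have cs: "cnj (struct_const p q m) = struct_const p q m" for p q m
    by (simp add: struct_const_def)
  have "ip k w (a \<otimes>\<^bsub>CS k\<^esub> g) =
      (\<Sum>m\<in>?X. \<Sum>p\<in>?X. \<Sum>q\<in>?X. cnj (a p) * w m * cnj (g q) * struct_const p q m)"
    by (simp add: ip_def mult sum_distrib_left cs mult_ac)
  also have "\<dots> = (\<Sum>p\<in>?X. \<Sum>q\<in>?X. \<Sum>m\<in>?X. cnj (a p) * w m * cnj (g q) * struct_const p q m)"
    by (rule sum_rotate)
  also have "\<dots> = (\<Sum>p\<in>?X. \<Sum>q\<in>?X. \<Sum>m\<in>?X. cnj (a (SE_inv p)) * w m * cnj (g q) * struct_const (SE_inv p) q m)"
    by (rule sum.reindex_bij_witness[of _ SE_inv SE_inv]) (simp_all add: SE_inv_inv SE_inv_hom)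
  also have "\<dots> = (\<Sum>p\<in>?X. \<Sum>q\<in>?X. \<Sum>m\<in>?X. adjoint k a p * w m * cnj (g q) * struct_const p m q)"
  proof -
    have "struct_const (SE_inv p) q m = struct_const p m q" if "p \<in> ?X" "q \<in> ?X" "m \<in> ?X" for p q m
      using struct_const_inv[OF that(1,3,2)] .
    then show ?thesis
      by (simp add: adjoint_def cong: sum.cong)
  qed
  also have "\<dots> = (\<Sum>q\<in>?X. \<Sum>p\<in>?X. \<Sum>m\<in>?X. adjoint k a p * w m * cnj (g q) * struct_const p m q)"
    by (rule sum.swap)
  also have "\<dots> = ip k (adjoint k a \<otimes>\<^bsub>CS k\<^esub> w) g"
    by (simp add: ip_def mult sum_distrib_left sum_distrib_right mult_ac)
  finally show ?thesis .
qed

lemma adjoint_closed: "adjoint k a \<in> carrier (CS k)"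
  unfolding SE_algebra_simps(1) SE_mors_single by (simp add: adjoint_def)

lemma ip_self_eq_0:
  assumes "x \<in> carrier (CS k)" "ip k x x = 0"
  shows "x = (\<lambda>m. 0)"
proof
  fix m
  have "ip k x x = of_real (\<Sum>m\<in>SE_hom k k. (cmod (x m))\<^sup>2)"
    by (simp only: ip_def of_real_sum complex_norm_square)
  with assms(2) have "complex_of_real (\<Sum>m\<in>SE_hom k k. (cmod (x m))\<^sup>2) = 0"
    by (simp only:)
  then have "(\<Sum>m\<in>SE_hom k k. (cmod (x m))\<^sup>2) = 0"
    by (rule of_real_eq_0_iff[THEN iffD1])
  then have "\<forall>m\<in>SE_hom k k. x m = 0"
    using finite_SE_hom by (simp add: sum_nonneg_eq_0_iff)
  then show "x m = 0"
    using SE_outside[OF assms(1), of m] by (auto simp: SE_mors_single)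
qed

lemma ip_diff_right: "ip k w (\<lambda>m. x m - y m) = ip k w x - ip k w y"
  by (simp add: ip_def algebra_simps sum_subtractf)

text \<open>
  This is the argument of Maschke in the form of orthogonal complements. Let \<open>U\<close> be the submodule
  generated by \<open>u\<close> and write \<open>e = f + g\<close> with \<open>f \<in> U\<close> and \<open>g\<close> orthogonal to \<open>U\<close>. The orthogonal
  complement of \<open>U\<close> is a submodule too, so \<open>f\<close> and \<open>g\<close> are orthogonal idempotents. As \<open>e\<close> is
  primitive and \<open>f\<close> acts as a right unit on \<open>U \<noteq> 0\<close>, this leaves \<open>g = 0\<close> and \<open>e = f \<in> U\<close>.
\<close>

lemma primitive_idempotent_generated:
  assumes prim: "primitive_idempotent (CS k) e" and u: "u \<in> carrier (left_ideal_module (CS k) e)"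
    and nz: "u \<noteq> (\<lambda>m. 0)"
  shows "\<exists>b\<in>carrier (CS k). b \<otimes>\<^bsub>CS k\<^esub> u = e"
proof -
  interpret A: ring "CS k"
    by (rule ring_SE_algebra) simp
  note closed = SE_mult_closed[of "{k}", simplified finite.intros]
  have add_def: "x \<oplus>\<^bsub>CS k\<^esub> y = (\<lambda>m. x m + y m)" for x y
    by simp
  have zero_def: "\<zero>\<^bsub>CS k\<^esub> = (\<lambda>m. 0)"
    by simp
  note [simp del] = SE_algebra_simps
  have e: "e \<in> carrier (CS k)" "e \<otimes>\<^bsub>CS k\<^esub> e = e"
    using prim by (auto simp: primitive_idempotent_def)
  have uA: "u \<in> carrier (CS k)" and ue: "u \<otimes>\<^bsub>CS k\<^esub> e = u"
    using u e by (auto simp: A.m_assoc)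
  define U where "U = (\<lambda>b. b \<otimes>\<^bsub>CS k\<^esub> u) ` carrier (CS k)"
  have UA: "w \<in> carrier (CS k)" and we: "w \<otimes>\<^bsub>CS k\<^esub> e = w" if "w \<in> U" for w
    using that uA ue e by (auto simp: U_def A.m_assoc)
  have U_mult: "a \<otimes>\<^bsub>CS k\<^esub> w \<in> U" if "a \<in> carrier (CS k)" "w \<in> U" for a w
    using that uA by (auto simp: U_def A.m_assoc[symmetric])
  have U_add: "(\<lambda>m. v m + w m) \<in> U" if vw: "v \<in> U" "w \<in> U" for v w
  proof -
    obtain b c where "b \<in> carrier (CS k)" "v = b \<otimes>\<^bsub>CS k\<^esub> u" "c \<in> carrier (CS k)" "w = c \<otimes>\<^bsub>CS k\<^esub> u"
      using vw by (auto simp: U_def)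
    then have "(\<lambda>m. v m + w m) = (b \<oplus>\<^bsub>CS k\<^esub> c) \<otimes>\<^bsub>CS k\<^esub> u" "b \<oplus>\<^bsub>CS k\<^esub> c \<in> carrier (CS k)"
      using uA by (simp_all add: A.l_distr add_def[symmetric])
    then show ?thesis
      by (auto simp: U_def)
  qed
  have U_scale: "(\<lambda>m. c * w m) \<in> U" if wU: "w \<in> U" for c w
  proof -
    obtain b where b: "b \<in> carrier (CS k)" "w = b \<otimes>\<^bsub>CS k\<^esub> u"
      using wU by (auto simp: U_def)
    have "(\<lambda>m. c * b m) \<in> carrier (CS k)"
      using SE_outside[OF b(1)] unfolding SE_algebra_simps(1) by simp
    moreover have "(\<lambda>m. c * w m) = (\<lambda>m. c * b m) \<otimes>\<^bsub>CS k\<^esub> u"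
      using b(2) by (simp add: SE_scale_mult)
    ultimately show ?thesis
      by (simp add: U_def)
  qed
  have U_zero: "(\<lambda>m. 0) \<in> U"
    using U_scale[of "\<one>\<^bsub>CS k\<^esub> \<otimes>\<^bsub>CS k\<^esub> u" 0] by (auto simp: U_def)
  have U_diff: "(\<lambda>m. v m - w m) \<in> U" if "v \<in> U" "w \<in> U" for v w
    using U_add[OF that(1) U_scale[OF that(2), of "- 1"]] by simp
  have sub: "fn.subspace U"
    using U_zero U_add U_scale by (intro fn.subspaceI) (auto simp: zero_fun_def plus_fun_def)
  obtain f where f: "f \<in> U" and orth: "\<And>w. w \<in> U \<Longrightarrow> (\<Sum>m\<in>SE_hom k k. w m * cnj (e m - f m)) = 0"
    by (rule orthogonal_projection[OF finite_SE_hom[of k k] sub, of e])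
      (use UA SE_outside[of _ "{k}"] in \<open>auto simp: SE_mors_single\<close>)
  define g where "g = (\<lambda>m. e m - f m)"
  note fA = UA[OF f]
  have gA: "g \<in> carrier (CS k)"
    using SE_outside[OF e(1)] SE_outside[OF fA] unfolding SE_algebra_simps(1) g_def by simp
  have efg: "e = f \<oplus>\<^bsub>CS k\<^esub> g"
    by (simp add: g_def add_def)
  have orth: "ip k w g = 0" if "w \<in> U" for w
    using orth[OF that] by (simp add: ip_def g_def)
  have orth': "ip k w (a \<otimes>\<^bsub>CS k\<^esub> g) = 0" if "w \<in> U" "a \<in> carrier (CS k)" for w a
    unfolding ip_adjoint using that by (intro orth U_mult adjoint_closed)
  have split: "w = (\<lambda>m. (w \<otimes>\<^bsub>CS k\<^esub> f) m + (w \<otimes>\<^bsub>CS k\<^esub> g) m)" if w: "w \<in> carrier (CS k)" "w \<otimes>\<^bsub>CS k\<^esub> e = w" for w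
  proof -
    have "w = (w \<otimes>\<^bsub>CS k\<^esub> f) \<oplus>\<^bsub>CS k\<^esub> (w \<otimes>\<^bsub>CS k\<^esub> g)"
      using A.r_distr[OF fA gA w(1)] w(2) unfolding efg[symmetric] by simp
    then show ?thesis
      unfolding add_def .
  qed
  have wg: "w \<otimes>\<^bsub>CS k\<^esub> g = (\<lambda>m. 0)" if w: "w \<in> U" for w
  proof (rule ip_self_eq_0)
    have "w \<otimes>\<^bsub>CS k\<^esub> g = (\<lambda>m. w m - (w \<otimes>\<^bsub>CS k\<^esub> f) m)"
      by (subst (2) split[OF UA[OF w] we[OF w]]) simp
    then have "w \<otimes>\<^bsub>CS k\<^esub> g \<in> U"
      using U_diff[OF w U_mult[OF UA[OF w] f]] by simp
    then show "ip k (w \<otimes>\<^bsub>CS k\<^esub> g) (w \<otimes>\<^bsub>CS k\<^esub> g) = 0"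
      using UA[OF w] by (rule orth')
  qed (use UA[OF w] gA in simp)
  have wf: "w \<otimes>\<^bsub>CS k\<^esub> f = w" if w: "w \<in> U" for w
    using split[OF UA[OF w] we[OF w]] wg[OF w] by simp
  \<comment> \<open>The element \<open>f - e f = e g - g\<close> lies in \<open>U\<close> and in its orthogonal complement.\<close>
  have ef: "e \<otimes>\<^bsub>CS k\<^esub> f = f"
  proof -
    let ?d = "\<lambda>m. f m - (e \<otimes>\<^bsub>CS k\<^esub> f) m"
    have dU: "?d \<in> U"
      using U_diff[OF f U_mult[OF e(1) f]] .
    have "?d = (\<lambda>m. (e \<otimes>\<^bsub>CS k\<^esub> g) m - g m)"
    proof
      fix m
      have "e m = (e \<otimes>\<^bsub>CS k\<^esub> f) m + (e \<otimes>\<^bsub>CS k\<^esub> g) m"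
        using fun_cong[OF split[OF e]] .
      then show "?d m = (e \<otimes>\<^bsub>CS k\<^esub> g) m - g m"
        by (simp add: g_def)
    qed
    then have "ip k ?d ?d = ip k ?d (\<lambda>m. (e \<otimes>\<^bsub>CS k\<^esub> g) m - g m)"
      by simp
    also have "\<dots> = 0"
      using orth'[OF dU e(1)] orth[OF dU] by (simp add: ip_diff_right)
    finally have "?d = (\<lambda>m. 0)"
      using UA[OF dU] by (intro ip_self_eq_0)
    then show ?thesis
      by (simp add: fun_eq_iff)
  qed
  have fe: "f \<otimes>\<^bsub>CS k\<^esub> e = f" and ff: "f \<otimes>\<^bsub>CS k\<^esub> f = f" and fg: "f \<otimes>\<^bsub>CS k\<^esub> g = \<zero>\<^bsub>CS k\<^esub>"
    using we[OF f] wf[OF f] wg[OF f] by (simp_all add: zero_def)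
  have "f \<oplus>\<^bsub>CS k\<^esub> (g \<otimes>\<^bsub>CS k\<^esub> f) = f"
    using A.l_distr[of f g f] fA gA ef ff by (simp add: efg[symmetric])
  then have gf: "g \<otimes>\<^bsub>CS k\<^esub> f = \<zero>\<^bsub>CS k\<^esub>"
    using fA gA by simp
  have "g \<otimes>\<^bsub>CS k\<^esub> e = (\<lambda>m. e m - f m)"
  proof -
    have "f \<oplus>\<^bsub>CS k\<^esub> (g \<otimes>\<^bsub>CS k\<^esub> e) = e"
      using A.l_distr[of f g e] fA gA e fe by (simp add: efg[symmetric])
    then have "f m + (g \<otimes>\<^bsub>CS k\<^esub> e) m = e m" for m
      unfolding add_def by (rule fun_cong)
    then show ?thesis
      by (intro ext) (simp add: eq_diff_eq add.commute)
  qed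
  then have gg: "g \<otimes>\<^bsub>CS k\<^esub> g = g"
    using A.r_distr[of f g g] fA gA gf by (simp add: efg[symmetric] g_def[symmetric])
  have "f = \<zero>\<^bsub>CS k\<^esub> \<or> g = \<zero>\<^bsub>CS k\<^esub>"
    using prim fA gA ff gg fg gf efg unfolding primitive_idempotent_def by metis
  then show ?thesis
  proof
    assume "f = \<zero>\<^bsub>CS k\<^esub>"
    moreover have "u \<in> U"
      using uA by (auto simp: U_def intro!: image_eqI[of _ _ "\<one>\<^bsub>CS k\<^esub>"])
    ultimately have "u = \<zero>\<^bsub>CS k\<^esub>"
      using wf[of u] uA by simp
    then show ?thesis
      using nz by (simp add: zero_def)
  next
    assume "g = \<zero>\<^bsub>CS k\<^esub>"
    then have "e = f"
      using efg fA by simp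
    then show ?thesis
      using f by (auto simp: U_def)
  qed
qed

section \<open>Indecomposable projective modules\<close>

declare SE_algebra_simps(1,3) [simp del]

lemma SE_add: "(x \<oplus>\<^bsub>SE_algebra Ob\<^esub> y) m = x m + y m"
  by (simp add: SE_algebra_simps(3))

context
  fixes n k :: nat and e :: "se_mor \<Rightarrow> complex"
  assumes k: "k \<le> n" and prim: "primitive_idempotent (CS k) e"
begin

interpretation A: ring "CSE n"
  by (rule ring_SE_algebra) simp

lemma CS_mult: "x \<in> carrier (CS k) \<Longrightarrow> y \<in> carrier (CS k) \<Longrightarrow> x \<otimes>\<^bsub>CS k\<^esub> y = x \<otimes>\<^bsub>CSE n\<^esub> y"
  using k by (intro SE_mult_subset) auto

lemma CS_sub: "x \<in> carrier (CS k) \<Longrightarrow> x \<in> carrier (CSE n)"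
  using carrier_SE_mono[of "{k}" "{0..n}"] k by (meson atLeastAtMost_iff empty_subsetI insert_subset le0 subsetD)

lemma e_CS: "e \<in> carrier (CS k)" "e \<otimes>\<^bsub>CSE n\<^esub> e = e" "e \<noteq> (\<lambda>m. 0)"
  using prim CS_mult[of e e] by (simp_all add: primitive_idempotent_def)

lemma unit_mult:
  assumes "x \<in> carrier (CSE n)"
  shows "obj_id {k} \<otimes>\<^bsub>CSE n\<^esub> x = (\<lambda>m. if tgt m = k then x m else 0)"
    and "x \<otimes>\<^bsub>CSE n\<^esub> obj_id {k} = (\<lambda>m. if src m = k then x m else 0)"
  using obj_id_mult[OF _ assms, of "{k}"] mult_obj_id[OF _ assms, of "{k}"] by simp_all

lemma unit_CS:
  assumes "x \<in> carrier (CS k)"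
  shows "obj_id {k} \<otimes>\<^bsub>CSE n\<^esub> x = x" "x \<otimes>\<^bsub>CSE n\<^esub> obj_id {k} = x"
  using SE_outside[OF assms] CS_sub[OF assms]
  by (auto simp: unit_mult SE_mors_single SE_hom_iff intro!: ext)

lemma proj_left_module: "left_module (CSE n) (proj_module n e)"
  unfolding proj_module_def by (rule A.left_ideal_left_module) (rule CS_sub[OF e_CS(1)])

lemma proj_simps [simp]:
  "carrier (proj_module n e) = (\<lambda>x. x \<otimes>\<^bsub>CSE n\<^esub> e) ` carrier (CSE n)"
  "zero (proj_module n e) = (\<lambda>m. 0)"
  "add (proj_module n e) = (\<lambda>x y m. x m + y m)"
  "smult (proj_module n e) = monoid.mult (CSE n)"
  by (simp_all add: proj_module_def) (simp add: SE_algebra_def)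

lemma proj_closed: "x \<in> carrier (proj_module n e) \<Longrightarrow> x \<in> carrier (CSE n)"
  using SE_mult_closed[of "{0..n}"] by auto

text \<open>
  The source is \<open>k\<close> because \<open>e\<close> consists of permutations of \<open>{1..k}\<close>, and an onto function cannot
  increase the number of elements.
\<close>

lemma proj_src:
  assumes "x \<in> carrier (proj_module n e)" "x m \<noteq> 0"
  shows "src m = k" "tgt m \<le> k"
proof -
  obtain y where "x = y \<otimes>\<^bsub>CSE n\<^esub> e"
    using assms(1) by auto
  then have nz: "(y \<otimes>\<^bsub>CSE n\<^esub> e) m \<noteq> 0"
    using assms(2) by simp
  obtain p q where pq: "p \<in> SE_mors {0..n}" "q \<in> SE_mors {0..n}" "y p \<noteq> 0" "e q \<noteq> 0"
      "SE_composable p q" "m = SE_comp p q"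
    by (rule SE_mult_support[OF _ nz]) simp_all
  have "q \<in> SE_hom k k"
    using pq(4) SE_outside[OF e_CS(1), of q] by (auto simp: SE_mors_single)
  then show "src m = k" "tgt m \<le> k"
    using pq SE_hom_le[of p k "tgt p"] by (auto simp: SE_composable_def SE_hom_iff SE_mors_iff)
qed

text \<open>
  As \<open>e\<close> commutes with the identity \<open>c\<close> of \<open>k\<close>, one has \<open>c y e = (c y c) e\<close>, and \<open>c y c\<close> involves
  endomorphisms of \<open>k\<close> only, which are permutations.
\<close>

lemma c_part_ideal:
  assumes "x \<in> carrier (proj_module n e)"
  shows "obj_id {k} \<otimes>\<^bsub>CSE n\<^esub> x \<in> carrier (left_ideal_module (CS k) e)"
proof -
  let ?c = "obj_id {k}"
  obtain y where y: "y \<in> carrier (CSE n)" "x = y \<otimes>\<^bsub>CSE n\<^esub> e"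
    using assms by auto
  have c: "?c \<in> carrier (CSE n)"
    using k by (intro obj_id_closed) auto
  let ?y = "?c \<otimes>\<^bsub>CSE n\<^esub> (y \<otimes>\<^bsub>CSE n\<^esub> ?c)"
  have "?y \<in> carrier (CS k)"
    unfolding SE_algebra_simps(1) SE_mors_single
  proof (intro allI impI)
    fix m assume "m \<notin> SE_hom k k"
    then have "y m = 0" if "src m = k" "tgt m = k"
      using SE_outside[OF y(1), of m] that by (simp add: SE_mors_iff)
    then show "?y m = 0"
      using unit_mult(1)[OF A.m_closed[OF y(1) c]] unit_mult(2)[OF y(1)] by simp
  qed
  moreover have "?c \<otimes>\<^bsub>CSE n\<^esub> x = ?y \<otimes>\<^bsub>CSE n\<^esub> e"
    using y c CS_sub[OF e_CS(1)] unit_CS(1)[OF e_CS(1)] by (simp add: A.m_assoc)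
  ultimately show ?thesis
    using CS_mult[OF _ e_CS(1)] by auto
qed

lemma ideal_sub_proj:
  assumes "x \<in> carrier (left_ideal_module (CS k) e)"
  shows "x \<in> carrier (proj_module n e)" "x \<in> carrier (CS k)"
proof -
  obtain y where "y \<in> carrier (CS k)" "x = y \<otimes>\<^bsub>CS k\<^esub> e"
    using assms by auto
  then show "x \<in> carrier (proj_module n e)" "x \<in> carrier (CS k)"
    using CS_sub CS_mult[OF _ e_CS(1)] SE_mult_closed[of "{k}" y e] by simp_all
qed

text \<open>
  The absorption law holds because a morphism of source \<open>k\<close> that does not reach target \<open>k\<close> has a
  target below \<open>k\<close>, and from there no morphism leads to \<open>k\<close>. A submodule with an element \<open>x\<close> for which
  \<open>c x \<noteq> 0\<close> contains \<open>e\<close>, since \<open>c x\<close> generates the simple left ideal \<open>\<complex>S\<^sub>k e\<close>.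
\<close>

theorem headed_proj: "headed_module (CSE n) (proj_module n e) (obj_id {k})"
proof -
  let ?c = "obj_id {k}" and ?P = "proj_module n e"
  interpret P: left_module "CSE n" ?P
    by (rule proj_left_module)
  have c: "?c \<in> carrier (CSE n)"
    using k by (intro obj_id_closed) auto
  have e: "e \<in> carrier (CSE n)"
    using CS_sub e_CS(1) .
  have eP: "e \<in> carrier ?P"
    using e e_CS(2) by (auto intro!: image_eqI[of _ _ e])
  show ?thesis
  proof (unfold_locales)
    show "?c \<in> carrier (CSE n)" by (rule c)
  next
    fix a x assume a: "a \<in> carrier (CSE n)" and x: "x \<in> carrier ?P"
    \<comment> \<open>The part of \<open>x\<close> whose targets lie below \<open>k\<close>.\<close>
    define z where "z = (\<lambda>m. if tgt m = k then 0 else x m)"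
    note xA = proj_closed[OF x]
    have zA: "z \<in> carrier (CSE n)"
      using SE_outside[OF xA] unfolding SE_algebra_simps(1) z_def by simp
    have xz: "x = (?c \<otimes>\<^bsub>CSE n\<^esub> x) \<oplus>\<^bsub>CSE n\<^esub> z"
      by (auto simp: unit_mult[OF xA] z_def SE_add intro!: ext)
    have az: "(a \<otimes>\<^bsub>CSE n\<^esub> z) m = 0" if m: "tgt m = k" for m
    proof (rule ccontr)
      assume nz: "(a \<otimes>\<^bsub>CSE n\<^esub> z) m \<noteq> 0"
      obtain p q where pq: "p \<in> SE_mors {0..n}" "q \<in> SE_mors {0..n}" "a p \<noteq> 0" "z q \<noteq> 0"
          "SE_composable p q" "m = SE_comp p q"
        by (rule SE_mult_support[OF _ nz]) simp_all
      have "x q \<noteq> 0" "tgt q \<noteq> k"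
        using pq(4) by (auto simp: z_def split: if_splits)
      moreover have "k \<le> tgt q"
        using pq m SE_hom_le[of p "src p" "tgt p"] by (auto simp: SE_mors_iff SE_composable_def)
      ultimately show False
        using proj_src(2)[OF x, of q] by simp
    qed
    have split: "a \<otimes>\<^bsub>CSE n\<^esub> x = (a \<otimes>\<^bsub>CSE n\<^esub> (?c \<otimes>\<^bsub>CSE n\<^esub> x)) \<oplus>\<^bsub>CSE n\<^esub> (a \<otimes>\<^bsub>CSE n\<^esub> z)"
      by (subst xz) (use a c xA zA in \<open>simp add: A.r_distr\<close>)
    have "(a \<otimes>\<^bsub>CSE n\<^esub> x) m = (a \<otimes>\<^bsub>CSE n\<^esub> (?c \<otimes>\<^bsub>CSE n\<^esub> x)) m" if "tgt m = k" for m
      using fun_cong[OF split, of m] unfolding SE_add az[OF that] add_0_right .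
    then show "?c \<odot>\<^bsub>?P\<^esub> (a \<odot>\<^bsub>?P\<^esub> x) = ?c \<odot>\<^bsub>?P\<^esub> (a \<odot>\<^bsub>?P\<^esub> (?c \<odot>\<^bsub>?P\<^esub> x))"
      using a c xA by (simp add: unit_mult(1)[of "a \<otimes>\<^bsub>CSE n\<^esub> x"]
          unit_mult(1)[of "a \<otimes>\<^bsub>CSE n\<^esub> (?c \<otimes>\<^bsub>CSE n\<^esub> x)"] fun_eq_iff)
  next
    fix U x assume U: "submodule U (CSE n) ?P" and x: "x \<in> U" and nz: "?c \<odot>\<^bsub>?P\<^esub> x \<noteq> \<zero>\<^bsub>?P\<^esub>"
    note U' = P.submoduleD[OF U]
    have xP: "x \<in> carrier ?P"
      using U'(1) x by blast
    let ?u = "?c \<otimes>\<^bsub>CSE n\<^esub> x"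
    note uI = c_part_ideal[OF xP]
    obtain b where b: "b \<in> carrier (CS k)" "b \<otimes>\<^bsub>CS k\<^esub> ?u = e"
      using primitive_idempotent_generated[OF prim uI] nz by auto
    have "b \<otimes>\<^bsub>CSE n\<^esub> ?u = e"
      using b CS_mult[OF b(1) ideal_sub_proj(2)[OF uI]] by simp
    moreover have "b \<otimes>\<^bsub>CSE n\<^esub> ?u \<in> U"
      using U'(4)[OF CS_sub[OF b(1)] U'(4)[OF c x]] by simp
    ultimately have "e \<in> U" by simp
    then have "carrier ?P \<subseteq> U"
      using U'(4) by auto
    then show "U = carrier ?P"
      using U'(1) by blast
  next
    show "\<exists>x\<in>carrier ?P. ?c \<odot>\<^bsub>?P\<^esub> x \<noteq> \<zero>\<^bsub>?P\<^esub>"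
      using eP unit_CS(1)[OF e_CS(1)] e_CS(3) by (intro bexI[of _ e]) simp_all
  qed
qed

lemma composition_series_proj: "\<exists>Ns. composition_series (CSE n) (proj_module n e) Ns"
proof (rule left_module.composition_series_exists[OF proj_left_module])
  fix U V assume U: "submodule U (CSE n) (proj_module n e)"
    and V: "submodule V (CSE n) (proj_module n e)" and less: "U \<subset> V"
  note U' = left_module.submoduleD[OF proj_left_module U]
  have UA: "x \<in> carrier (CSE n)" if "x \<in> U" for x
    using U'(1) proj_closed that by blast
  have VA: "x \<in> carrier (CSE n)" if "x \<in> V" for x
    using left_module.submoduleD(1)[OF proj_left_module V] proj_closed that by blast
  have "fn.subspace U"
  proof (rule fn.subspaceI)
    fix c x assume x: "x \<in> U"
    have "(\<lambda>m. c * \<one>\<^bsub>CSE n\<^esub> m) \<in> carrier (CSE n)"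
      using SE_outside[OF A.one_closed] unfolding SE_algebra_simps(1) by simp
    moreover have "(\<lambda>m. c * \<one>\<^bsub>CSE n\<^esub> m) \<otimes>\<^bsub>CSE n\<^esub> x = (\<lambda>m. c * x m)"
      using A.l_one[OF UA[OF x]] by (subst SE_scale_mult) simp_all
    ultimately show "(\<lambda>m. c * x m) \<in> U"
      using U'(4)[OF _ x] by force
  qed (use U'(2,3) in \<open>simp_all add: zero_fun_def plus_fun_def\<close>)
  then show "fn.dim U < fn.dim V"
    using less SE_outside[OF VA] by (intro dim_strict_mono[OF finite_SE_mors[of "{0..n}"]]) auto
qed

lemma top_module_eq:
  "top_module n e = quotient_module (proj_module n e) (headed_module.rad (proj_module n e) (obj_id {k}))"
  by (simp add: top_module_def headed_module.module_radical_eq[OF headed_proj])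

lemma top_acts_unit: "acts_nonconstantly (top_module n e) (obj_id {k})"
  unfolding top_module_eq by (rule headed_module.acts_on_top[OF headed_proj])

text \<open>
  The map \<open>x \<mapsto> c x\<close> from \<open>P(\<alpha>)\<close> onto the left ideal of the group algebra has the radical as its
  kernel and commutes with the action of the group algebra.
\<close>

lemma top_acts_iff:
  assumes a: "a \<in> carrier (CS k)"
  shows "acts_nonconstantly (top_module n e) a \<longleftrightarrow> acts_nonconstantly (left_ideal_module (CS k) e) a"
proof -
  let ?c = "obj_id {k}" and ?P = "proj_module n e" and ?I = "left_ideal_module (CS k) e"
  have c: "?c \<in> carrier (CSE n)"
    using k by (intro obj_id_closed) auto
  have cax: "?c \<otimes>\<^bsub>CSE n\<^esub> (a \<otimes>\<^bsub>CSE n\<^esub> x) = a \<otimes>\<^bsub>CS k\<^esub> (?c \<otimes>\<^bsub>CSE n\<^esub> x)" if x: "x \<in> carrier ?P" for x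
  proof -
    have "?c \<otimes>\<^bsub>CSE n\<^esub> (a \<otimes>\<^bsub>CSE n\<^esub> x) = (?c \<otimes>\<^bsub>CSE n\<^esub> a) \<otimes>\<^bsub>CSE n\<^esub> x"
      using c CS_sub[OF a] proj_closed[OF x] by (simp add: A.m_assoc)
    also have "\<dots> = (a \<otimes>\<^bsub>CSE n\<^esub> ?c) \<otimes>\<^bsub>CSE n\<^esub> x"
      by (simp only: unit_CS[OF a])
    also have "\<dots> = a \<otimes>\<^bsub>CS k\<^esub> (?c \<otimes>\<^bsub>CSE n\<^esub> x)"
      using c CS_sub[OF a] proj_closed[OF x] CS_mult[OF a ideal_sub_proj(2)[OF c_part_ideal[OF x]]]
      by (simp add: A.m_assoc)
    finally show ?thesis .
  qed
  have "acts_nonconstantly (top_module n e) a \<longleftrightarrow>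
    (\<exists>x\<in>carrier ?P. \<exists>y\<in>carrier ?P. a \<otimes>\<^bsub>CS k\<^esub> (?c \<otimes>\<^bsub>CSE n\<^esub> x) \<noteq> a \<otimes>\<^bsub>CS k\<^esub> (?c \<otimes>\<^bsub>CSE n\<^esub> y))"
    unfolding top_module_eq headed_module.acts_on_top_iff[OF headed_proj CS_sub[OF a]] 
    unfolding proj_simps(4) using cax by (simp cong: bex_cong del: proj_simps(1))
  also have "\<dots> \<longleftrightarrow> (\<exists>x\<in>carrier ?I. \<exists>y\<in>carrier ?I. a \<otimes>\<^bsub>CS k\<^esub> x \<noteq> a \<otimes>\<^bsub>CS k\<^esub> y)"
  proof -
    have "(\<lambda>x. ?c \<otimes>\<^bsub>CSE n\<^esub> x) ` carrier ?P = carrier ?I"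
    proof
      show "carrier ?I \<subseteq> (\<lambda>x. ?c \<otimes>\<^bsub>CSE n\<^esub> x) ` carrier ?P"
      proof
        fix x assume x: "x \<in> carrier ?I"
        have "x = ?c \<otimes>\<^bsub>CSE n\<^esub> x"
          using unit_CS(1)[OF ideal_sub_proj(2)[OF x]] by simp
        then show "x \<in> (\<lambda>x. ?c \<otimes>\<^bsub>CSE n\<^esub> x) ` carrier ?P"
          using ideal_sub_proj(1)[OF x] by (rule image_eqI)
      qed
    qed (use c_part_ideal in blast)
    note image = this
    show ?thesis
      unfolding image[symmetric] by (simp only: bex_simps)
  qed
  finally show ?thesis
    by (simp add: acts_nonconstantly_def)
qed

lemma jh_multiplicity_proj_top:
  assumes "acts_nonconstantly X (obj_id {k})"
  shows "jh_multiplicity (CSE n) (proj_module n e) X =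
    (if module_iso (CSE n) (top_module n e) X then 1 else 0)"
  unfolding top_module_eq
  using headed_module.jh_multiplicity_top[OF headed_proj composition_series_proj assms] .

lemma jh_multiplicity_proj_above:
  assumes l: "k < l" "l \<le> n" and X: "acts_nonconstantly X (obj_id {l})"
  shows "jh_multiplicity (CSE n) (proj_module n e) X = 0"
proof (rule left_module.jh_multiplicity_eq_0[OF proj_left_module composition_series_proj _ _ X])
  show c: "obj_id {l} \<in> carrier (CSE n)"
    using l by (intro obj_id_closed) auto
  fix x assume x: "x \<in> carrier (proj_module n e)"
  have "obj_id {l} \<otimes>\<^bsub>CSE n\<^esub> x = (\<lambda>m. if tgt m = l then x m else 0)"
    using obj_id_mult[OF _ proj_closed[OF x], of "{l}"] by simp
  also have "\<dots> = (\<lambda>m. 0)"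
    using proj_src(2)[OF x] l by (force intro!: ext)
  finally show "obj_id {l} \<odot>\<^bsub>proj_module n e\<^esub> x = \<zero>\<^bsub>proj_module n e\<^esub>"
    by simp
qed

end

lemma top_left_module:
  assumes "k \<le> n" "primitive_idempotent (CS k) e"
  shows "left_module (CSE n) (top_module n e)"
  unfolding top_module_eq[OF assms]
  using left_module.quotient_left_module[OF proj_left_module[OF assms]
      headed_module.submodule_rad[OF headed_proj[OF assms]]] .

section \<open>Partitions and dominance\<close>

lemma finite_cells [simp]: "finite (cells \<alpha>)"
proof -
  have "cells \<alpha> = Sigma {..<length \<alpha>} (\<lambda>i. {..<\<alpha> ! i})"
    by (auto simp: cells_def)
  then show ?thesis by simp
qed

lemma card_cells_upper: "card {c \<in> cells \<alpha>. fst c < r} = sum_list (take r \<alpha>)"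
proof -
  have "{c \<in> cells \<alpha>. fst c < r} = Sigma {..<min r (length \<alpha>)} (\<lambda>i. {..<\<alpha> ! i})"
    by (auto simp: cells_def)
  then have "card {c \<in> cells \<alpha>. fst c < r} = (\<Sum>i<min r (length \<alpha>). \<alpha> ! i)"
    by simp
  also have "\<dots> = sum_list (take r \<alpha>)"
    by (simp add: sum_list_sum_nth atLeast0LessThan min.commute)
  finally show ?thesis .
qed

lemma card_cells: "card (cells \<alpha>) = sum_list \<alpha>"
proof -
  have "{c \<in> cells \<alpha>. fst c < length \<alpha>} = cells \<alpha>"
    by (auto simp: cells_def)
  then show ?thesis
    using card_cells_upper[of \<alpha> "length \<alpha>"] by simp
qed

lemma cells_column_down:
  assumes "sorted_wrt (\<ge>) \<alpha>" "(i, j) \<in> cells \<alpha>" "i' \<le> i"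
  shows "(i', j) \<in> cells \<alpha>"
  using assms sorted_wrt_nth_less[of "(\<ge>)" \<alpha> i' i] by (cases "i' = i") (auto simp: cells_def)

text \<open>
  Dominance is antisymmetric: a partition is determined by the sums of its first parts. The parts must
  be nonzero, as zeros at the end of a list do not change these sums.
\<close>

lemma partial_sums_inject:
  fixes \<alpha> \<beta> :: "nat list"
  assumes "0 \<notin> set \<alpha>" "0 \<notin> set \<beta>" "\<And>r. sum_list (take r \<alpha>) = sum_list (take r \<beta>)"
  shows "\<alpha> = \<beta>"
  using assms
proof (induction \<alpha> arbitrary: \<beta>)
  case Nil
  then show ?case
    using Nil(3)[of 1] by (cases \<beta>) auto
next
  case (Cons a as)
  obtain b bs where \<beta>: "\<beta> = b # bs"
    using Cons.prems(1) Cons.prems(3)[of 1] by (cases \<beta>) auto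
  have "a = b"
    using Cons.prems(3)[of 1] \<beta> by simp
  moreover have "sum_list (take r as) = sum_list (take r bs)" for r
    using Cons.prems(3)[of "Suc r"] \<beta> \<open>a = b\<close> by simp
  ultimately show ?case
    using Cons.IH[of bs] Cons.prems(1,2) \<beta> by auto
qed

lemma tableauxD:
  assumes "t \<in> tableaux \<alpha>"
  shows "t \<in> extensional (cells \<alpha>)" "inj_on t (cells \<alpha>)" "t ` cells \<alpha> = {1..sum_list \<alpha>}"
  using assms by (auto simp: tableaux_def bij_betw_def)

lemma tableau_mem: "t \<in> tableaux \<alpha> \<Longrightarrow> c \<in> cells \<alpha> \<Longrightarrow> t c \<in> {1..sum_list \<alpha>}"
  using tableauxD(3) by blast

lemma tableau_cell:
  assumes "t \<in> tableaux \<alpha>" "x \<in> {1..sum_list \<alpha>}"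
  obtains c where "c \<in> cells \<alpha>" "t c = x"
  using assms(2) that unfolding tableauxD(3)[OF assms(1), symmetric] by blast

lemma finite_tableaux: "finite (tableaux \<alpha>)"
proof (rule finite_subset)
  show "tableaux \<alpha> \<subseteq> cells \<alpha> \<rightarrow>\<^sub>E {1..sum_list \<alpha>}"
    by (auto simp: tableaux_def PiE_def Pi_def dest!: bij_betwE)
qed (auto intro: finite_PiE)

lemma tableau_exists: "\<exists>t. t \<in> tableaux \<alpha>"
proof -
  obtain f where "bij_betw f (cells \<alpha>) {1..sum_list \<alpha>}"
    using finite_same_card_bij[of "cells \<alpha>" "{1..sum_list \<alpha>}"] card_cells by auto
  then have "restrict f (cells \<alpha>) \<in> tableaux \<alpha>"
    by (simp add: tableaux_def bij_betw_restrict_eq)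
  then show ?thesis by blast
qed

lemma row_entries_iff: "x \<in> row_entries \<alpha> t i \<longleftrightarrow> (\<exists>j. (i, j) \<in> cells \<alpha> \<and> t (i, j) = x)"
  by (force simp: row_entries_def)

lemma column_entries_iff: "x \<in> column_entries \<alpha> t j \<longleftrightarrow> (\<exists>i. (i, j) \<in> cells \<alpha> \<and> t (i, j) = x)"
  by (force simp: column_entries_def)

lemma row_entries_disjoint:
  assumes "t \<in> tableaux \<alpha>" "x \<in> row_entries \<alpha> t i" "x \<in> row_entries \<alpha> t i'"
  shows "i = i'"
proof -
  obtain j j' where "(i, j) \<in> cells \<alpha>" "t (i, j) = x" "(i', j') \<in> cells \<alpha>" "t (i', j') = x"
    using assms(2,3) by (auto simp: row_entries_iff)
  then have "(i, j) = (i', j')"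
    by (intro inj_onD[OF tableauxD(2)[OF assms(1)]]) simp_all
  then show ?thesis by simp
qed

lemma column_entries_disjoint:
  assumes "t \<in> tableaux \<alpha>" "x \<in> column_entries \<alpha> t j" "x \<in> column_entries \<alpha> t j'"
  shows "j = j'"
proof -
  obtain i i' where "(i, j) \<in> cells \<alpha>" "t (i, j) = x" "(i', j') \<in> cells \<alpha>" "t (i', j') = x"
    using assms(2,3) by (auto simp: column_entries_iff)
  then have "(i, j) = (i', j')"
    by (intro inj_onD[OF tableauxD(2)[OF assms(1)]]) simp_all
  then show ?thesis by simp
qed

text \<open>
  The entries in the first \<open>r\<close> rows of \<open>s\<close> are looked up in \<open>t\<close>. By assumption a column
  of \<open>t\<close> contains at most one entry from each row of \<open>s\<close>, so at most \<open>r\<close> of these entries. Since columns of a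
  Young diagram have no gaps, a column with \<open>h\<close> cells meets the first \<open>r\<close> rows of \<open>\<alpha>\<close> in
  \<open>min r h\<close> cells; summing over the columns gives the claim.
\<close>

lemma dominance:
  assumes s: "s \<in> tableaux \<beta>" and t: "t \<in> tableaux \<alpha>" and sum: "sum_list \<beta> = sum_list \<alpha>"
    and \<alpha>: "sorted_wrt (\<ge>) \<alpha>"
    and sep: "\<And>a b i j. a \<in> row_entries \<beta> s i \<Longrightarrow> b \<in> row_entries \<beta> s i \<Longrightarrow>
      a \<in> column_entries \<alpha> t j \<Longrightarrow> b \<in> column_entries \<alpha> t j \<Longrightarrow> a = b"
  shows "sum_list (take r \<beta>) \<le> sum_list (take r \<alpha>)"
proof -
  \<comment> \<open>\<open>B\<close> consists of the cells of \<open>\<alpha>\<close> that carry in \<open>t\<close> an entry of the first \<open>r\<close> rows of \<open>s\<close>.\<close>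
  define B where "B = {c \<in> cells \<alpha>. \<exists>d\<in>cells \<beta>. fst d < r \<and> s d = t c}"
  define J where "J = snd ` cells \<alpha>"
  let ?D = "{d \<in> cells \<beta>. fst d < r}"
  have finB: "finite B"
    by (simp add: B_def)
  have image: "s ` ?D = t ` B"
  proof
    show "s ` ?D \<subseteq> t ` B"
    proof
      fix x assume "x \<in> s ` ?D"
      then obtain d where d: "d \<in> cells \<beta>" "fst d < r" "x = s d" by auto
      have "x \<in> {1..sum_list \<alpha>}"
        using tableau_mem[OF s d(1)] d(3) sum by simp
      then obtain c where c: "c \<in> cells \<alpha>" "t c = x"
        by (rule tableau_cell[OF t])
      then have "c \<in> B"
        using d by (auto simp: B_def)
      then show "x \<in> t ` B"
        using c(2) by blast
    qed
  next
    show "t ` B \<subseteq> s ` ?D"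
      by (force simp: B_def)
  qed
  have injs: "inj_on s ?D"
    by (rule inj_on_subset[OF tableauxD(2)[OF s]]) auto
  have injt: "inj_on t B"
    by (rule inj_on_subset[OF tableauxD(2)[OF t]]) (auto simp: B_def)
  have "card ?D = card B"
    unfolding card_image[OF injs, symmetric] card_image[OF injt, symmetric] image ..
  have "card {c \<in> B. snd c = j} \<le> card {c \<in> {c \<in> cells \<alpha>. fst c < r}. snd c = j}" for j
  proof -
    define H where "H = {i. (i, j) \<in> cells \<alpha>}"
    \<comment> \<open>\<open>\<rho> c\<close> is the row of \<open>s\<close> that contains the entry of \<open>t\<close> at \<open>c\<close>.\<close>
    define \<rho> where "\<rho> c = (SOME i. \<exists>d\<in>cells \<beta>. fst d = i \<and> i < r \<and> s d = t c)" for c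
    have \<rho>: "\<exists>d\<in>cells \<beta>. fst d = \<rho> c \<and> \<rho> c < r \<and> s d = t c" if "c \<in> B" for c
      unfolding \<rho>_def by (rule someI_ex) (use that in \<open>auto simp: B_def\<close>)
    have col: "t c \<in> column_entries \<alpha> t j" if "c \<in> B" "snd c = j" for c
      using that by (cases c) (auto simp: column_entries_iff B_def)
    have row: "t c \<in> row_entries \<beta> s (\<rho> c)" if cB: "c \<in> B" for c
    proof -
      obtain d where d: "d \<in> cells \<beta>" "fst d = \<rho> c" "s d = t c"
        using \<rho>[OF cB] by blast
      then have "d = (\<rho> c, snd d)"
        by (simp add: prod_eq_iff)
      then show ?thesis
        unfolding row_entries_iff using d(1,3) by (intro exI[of _ "snd d"]) simp
    qed
    have "inj_on \<rho> {c \<in> B. snd c = j}"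
    proof (rule inj_onI)
      fix c c' assume c: "c \<in> {c \<in> B. snd c = j}" "c' \<in> {c \<in> B. snd c = j}" "\<rho> c = \<rho> c'"
      have "t c = t c'"
        using c row[of c] row[of c'] col[of c] col[of c'] by (intro sep) auto
      then show "c = c'"
        using c tableauxD(2)[OF t] by (auto simp: B_def inj_on_eq_iff)
    qed
    moreover have "\<rho> ` {c \<in> B. snd c = j} \<subseteq> {..<r}"
      using \<rho> by auto
    ultimately have 1: "card {c \<in> B. snd c = j} \<le> r"
      using card_inj_on_le[of \<rho> "{c \<in> B. snd c = j}" "{..<r}"] by simp
    have H: "H = fst ` {c \<in> cells \<alpha>. snd c = j}"
      by (force simp: H_def)
    have finH: "finite H"
      unfolding H by simp
    have inj: "inj_on fst {c. snd c = j}" for j :: nat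
      by (auto simp: inj_on_def)
    have "card {c \<in> B. snd c = j} \<le> card {c \<in> cells \<alpha>. snd c = j}"
      by (rule card_mono) (auto simp: B_def)
    also have "\<dots> = card H"
      unfolding H by (rule card_image[symmetric], rule inj_on_subset[OF inj[of j]]) auto
    finally have 2: "card {c \<in> B. snd c = j} \<le> card H" .
    define h where "h = card H"
    have "H \<subseteq> {..<h}"
    proof
      fix i assume "i \<in> H"
      then have "{..i} \<subseteq> H"
        using cells_column_down[OF \<alpha>, of i j] by (auto simp: H_def)
      then show "i \<in> {..<h}"
        using card_mono[OF finH, of "{..i}"] by (simp add: h_def)
    qed
    then have "H = {..<h}"
      by (intro card_subset_eq) (simp_all add: h_def)
    then have upper: "{i \<in> H. i < r} = {..<min r h}"
      by auto
    have fst_image: "{i \<in> H. i < r} = fst ` {c \<in> {c \<in> cells \<alpha>. fst c < r}. snd c = j}"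
      by (force simp: H_def)
    have "card (fst ` {c \<in> {c \<in> cells \<alpha>. fst c < r}. snd c = j}) =
        card {c \<in> {c \<in> cells \<alpha>. fst c < r}. snd c = j}"
      by (rule card_image, rule inj_on_subset[OF inj[of j]]) auto
    then have "card {c \<in> {c \<in> cells \<alpha>. fst c < r}. snd c = j} = min r h"
      unfolding fst_image[symmetric] upper by simp
    then show ?thesis
      using 1 2 by (simp add: h_def)
  qed
  then have le: "(\<Sum>j\<in>J. card {c \<in> B. snd c = j}) \<le>
      (\<Sum>j\<in>J. card {c \<in> {c \<in> cells \<alpha>. fst c < r}. snd c = j})"
    by (rule sum_mono)
  have by_column: "(\<Sum>j\<in>J. card {c \<in> X. snd c = j}) = card X" if "X \<subseteq> cells \<alpha>" for X
    using sum.group[of X J snd "\<lambda>_. 1::nat"] that finite_subset[OF that] by (auto simp: J_def)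
  have sub: "B \<subseteq> cells \<alpha>" "{c \<in> cells \<alpha>. fst c < r} \<subseteq> cells \<alpha>"
    by (auto simp: B_def)
  from le have "card B \<le> card {c \<in> cells \<alpha>. fst c < r}"
    unfolding sub[THEN by_column] .
  then show ?thesis
    using \<open>card ?D = card B\<close> by (simp add: card_cells_upper)
qed

section \<open>Permutations acting on tabloids\<close>

abbreviation act :: "nat list \<Rightarrow> (nat \<Rightarrow> nat) \<Rightarrow> (nat \<times> nat \<Rightarrow> nat) \<Rightarrow> nat \<times> nat \<Rightarrow> nat" where
  "act \<alpha> \<pi> t \<equiv> compose (cells \<alpha>) \<pi> t"

lemma act_tableau:
  assumes "\<pi> permutes {1..sum_list \<alpha>}" "t \<in> tableaux \<alpha>"
  shows "act \<alpha> \<pi> t \<in> tableaux \<alpha>"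
  using assms bij_betw_trans[OF _ permutes_imp_bij[OF assms(1)], of t "cells \<alpha>"]
  by (auto simp: tableaux_def compose_def bij_betw_restrict_eq comp_def)

lemma act_act: "act \<alpha> \<sigma> (act \<alpha> \<pi> t) = act \<alpha> (\<sigma> \<circ> \<pi>) t"
  by (auto simp: compose_def restrict_def)

lemma act_id: "t \<in> tableaux \<alpha> \<Longrightarrow> act \<alpha> id t = t"
  by (auto simp: compose_def restrict_def tableaux_def extensional_def)

lemma row_entries_act: "row_entries \<alpha> (act \<alpha> \<pi> t) i = \<pi> ` row_entries \<alpha> t i"
  by (auto simp: row_entries_def compose_def image_image intro!: image_cong)

lemma tabloid_self: "t \<in> tableaux \<alpha> \<Longrightarrow> t \<in> tabloid \<alpha> t"
  by (simp add: tabloid_def)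

lemma tabloid_eq_iff:
  assumes "s \<in> tableaux \<alpha>" "t \<in> tableaux \<alpha>"
  shows "tabloid \<alpha> s = tabloid \<alpha> t \<longleftrightarrow> (\<forall>i. row_entries \<alpha> s i = row_entries \<alpha> t i)"
proof
  assume "tabloid \<alpha> s = tabloid \<alpha> t"
  then have "s \<in> tabloid \<alpha> t"
    using tabloid_self[OF assms(1)] by simp
  then show "\<forall>i. row_entries \<alpha> s i = row_entries \<alpha> t i"
    by (simp add: tabloid_def)
qed (simp add: tabloid_def)

definition perm_mor :: "nat \<Rightarrow> (nat \<Rightarrow> nat) \<Rightarrow> se_mor" where
  "perm_mor k \<pi> = (k, k, restrict \<pi> {1..k})"

lemma perm_mor_hom: "\<pi> permutes {1..k} \<Longrightarrow> perm_mor k \<pi> \<in> SE_hom k k"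
  using permutes_image[of \<pi> "{1..k}"] by (simp add: SE_hom_iff perm_mor_def)

lemma tabloid_action_perm:
  assumes \<pi>: "\<pi> permutes {1..sum_list \<alpha>}" and t: "t \<in> tableaux \<alpha>"
  shows "tabloid_action \<alpha> (perm_mor (sum_list \<alpha>) \<pi>) (tabloid \<alpha> t) = tabloid \<alpha> (act \<alpha> \<pi> t)"
proof -
  have "compose (cells \<alpha>) (restrict \<pi> {1..sum_list \<alpha>}) s = act \<alpha> \<pi> s" if "s \<in> tableaux \<alpha>" for s
    using tableau_mem[OF that] by (auto simp: compose_def restrict_def)
  then have "tabloid_action \<alpha> (perm_mor (sum_list \<alpha>) \<pi>) (tabloid \<alpha> t) = act \<alpha> \<pi> ` tabloid \<alpha> t"
    by (auto simp: tabloid_action_def perm_mor_def tabloid_def intro!: image_cong)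
  also have "\<dots> = tabloid \<alpha> (act \<alpha> \<pi> t)"
  proof
    show "act \<alpha> \<pi> ` tabloid \<alpha> t \<subseteq> tabloid \<alpha> (act \<alpha> \<pi> t)"
      using act_tableau[OF \<pi>] by (auto simp: tabloid_def row_entries_act)
  next
    show "tabloid \<alpha> (act \<alpha> \<pi> t) \<subseteq> act \<alpha> \<pi> ` tabloid \<alpha> t"
    proof
      fix s assume "s \<in> tabloid \<alpha> (act \<alpha> \<pi> t)"
      then have s: "s \<in> tableaux \<alpha>" "\<And>i. row_entries \<alpha> s i = \<pi> ` row_entries \<alpha> t i"
        by (auto simp: tabloid_def row_entries_act)
      let ?s = "act \<alpha> (inv_into UNIV \<pi>) s"
      have "?s \<in> tabloid \<alpha> t"
        using act_tableau[OF permutes_inv[OF \<pi>] s(1)] permutes_inv_o(2)[OF \<pi>]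
        by (simp add: tabloid_def row_entries_act s(2) image_comp)
      moreover have "s = act \<alpha> \<pi> ?s"
        using act_id[OF s(1)] permutes_inv_o(1)[OF \<pi>] by (simp add: act_act)
      ultimately show "s \<in> act \<alpha> \<pi> ` tabloid \<alpha> t" by blast
    qed
  qed
  finally show ?thesis .
qed

lemma column_stabilizer_permutes: "\<pi> \<in> column_stabilizer \<alpha> t \<Longrightarrow> \<pi> permutes {1..sum_list \<alpha>}"
  by (simp add: column_stabilizer_def)

lemma column_stabilizer_comp:
  assumes "\<sigma> \<in> column_stabilizer \<alpha> t" "\<pi> \<in> column_stabilizer \<alpha> t"
  shows "\<sigma> \<circ> \<pi> \<in> column_stabilizer \<alpha> t"
proof -
  have "(\<sigma> \<circ> \<pi>) ` column_entries \<alpha> t j = column_entries \<alpha> t j" for j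
    using assms unfolding column_stabilizer_def image_comp[symmetric] by simp
  then show ?thesis
    using permutes_compose[OF column_stabilizer_permutes[OF assms(2)] column_stabilizer_permutes[OF assms(1)]]
    unfolding column_stabilizer_def by (intro CollectI conjI allI)
qed

lemma column_stabilizer_inv:
  assumes "\<sigma> \<in> column_stabilizer \<alpha> t"
  shows "inv_into UNIV \<sigma> \<in> column_stabilizer \<alpha> t"
proof -
  note \<sigma> = column_stabilizer_permutes[OF assms]
  have "inv_into UNIV \<sigma> ` column_entries \<alpha> t j = column_entries \<alpha> t j" for j
  proof -
    have "inv_into UNIV \<sigma> ` (\<sigma> ` column_entries \<alpha> t j) = column_entries \<alpha> t j"
      using permutes_inv_o(2)[OF \<sigma>] by (simp add: image_comp)
    then show ?thesis
      using assms by (simp add: column_stabilizer_def)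
  qed
  then show ?thesis
    using permutes_inv[OF \<sigma>] by (simp add: column_stabilizer_def)
qed

lemma finite_column_stabilizer: "finite (column_stabilizer \<alpha> t)"
  by (rule finite_subset[OF _ finite_permutations[of "{1..sum_list \<alpha>}"]])
    (auto simp: column_stabilizer_def)

lemma id_column_stabilizer: "id \<in> column_stabilizer \<alpha> t"
  by (simp add: column_stabilizer_def permutes_id)

text \<open>
  A cell is the only common cell of its row and its column.
\<close>

lemma row_column_stabilizer_trivial:
  assumes t: "t \<in> tableaux \<alpha>" and \<rho>: "\<rho> \<in> column_stabilizer \<alpha> t"
    and rows: "\<And>i. \<rho> ` row_entries \<alpha> t i = row_entries \<alpha> t i"
  shows "\<rho> = id"
proof
  fix x
  show "\<rho> x = id x"
  proof (cases "x \<in> {1..sum_list \<alpha>}")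
    case True
    then obtain c where "c \<in> cells \<alpha>" "t c = x"
      by (rule tableau_cell[OF t])
    then obtain i j where ij: "(i, j) \<in> cells \<alpha>" "t (i, j) = x"
      by (cases c) auto
    have "\<rho> x \<in> row_entries \<alpha> t i"
      using rows[of i] ij row_entries_iff[of x \<alpha> t i] by blast
    moreover have "\<rho> x \<in> column_entries \<alpha> t j"
      using \<rho> ij column_entries_iff[of x \<alpha> t j] unfolding column_stabilizer_def by blast
    ultimately obtain i' j' where "(i, j') \<in> cells \<alpha>" "t (i, j') = \<rho> x" "(i', j) \<in> cells \<alpha>" "t (i', j) = \<rho> x"
      unfolding row_entries_iff column_entries_iff by blast
    moreover from this have "(i, j') = (i', j)"
      by (intro inj_onD[OF tableauxD(2)[OF t]]) simp_all
    ultimately show ?thesis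
      using ij by simp
  next
    case False
    then show ?thesis
      using column_stabilizer_permutes[OF \<rho>] by (simp add: permutes_def)
  qed
qed

section \<open>Column antisymmetrizers\<close>

definition antisymmetrizer :: "nat list \<Rightarrow> (nat \<times> nat \<Rightarrow> nat) \<Rightarrow> se_mor \<Rightarrow> complex" where
  "antisymmetrizer \<alpha> t = (\<lambda>m. \<Sum>\<pi>\<in>column_stabilizer \<alpha> t.
     of_int (sign \<pi>) * (if perm_mor (sum_list \<alpha>) \<pi> = m then 1 else 0))"

lemma antisymmetrizer_closed: "antisymmetrizer \<alpha> t \<in> carrier (CS (sum_list \<alpha>))"
  unfolding SE_algebra_simps(1) SE_mors_single antisymmetrizer_def
proof (intro allI impI sum.neutral ballI)
  fix m \<pi> assume "m \<notin> SE_hom (sum_list \<alpha>) (sum_list \<alpha>)" "\<pi> \<in> column_stabilizer \<alpha> t"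
  then have "perm_mor (sum_list \<alpha>) \<pi> \<noteq> m"
    using perm_mor_hom column_stabilizer_permutes by blast
  then show "of_int (sign \<pi>) * (if perm_mor (sum_list \<alpha>) \<pi> = m then 1 else 0) = (0::complex)"
    by simp
qed

lemma antisymmetrizer_smult:
  assumes "sum_list \<beta> = sum_list \<alpha>"
  shows "(antisymmetrizer \<alpha> t \<odot>\<^bsub>specht_module \<beta>\<^esub> v) T =
    (\<Sum>U\<in>tabloid \<beta> ` tableaux \<beta>. v U * (\<Sum>\<sigma>\<in>column_stabilizer \<alpha> t. of_int (sign \<sigma>) *
      (if tabloid_action \<beta> (perm_mor (sum_list \<alpha>) \<sigma>) U = T then 1 else 0)))"
proof -
  let ?k = "sum_list \<alpha>" and ?C = "column_stabilizer \<alpha> t" and ?T = "tabloid \<beta> ` tableaux \<beta>"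
  let ?H = "SE_hom ?k ?k" and ?x = "antisymmetrizer \<alpha> t"
  have fin: "finite ?T" "finite ?H"
    by (simp_all add: finite_tableaux finite_SE_hom)
  have "(?x \<odot>\<^bsub>specht_module \<beta>\<^esub> v) T =
      (\<Sum>(m, U) \<in> {(m, U) \<in> ?H \<times> ?T. tabloid_action \<beta> m U = T}. ?x m * v U)"
    using assms by (auto simp: specht_module_def intro!: sum.cong)
  also have "\<dots> = (\<Sum>(m, U) \<in> ?H \<times> ?T. ?x m * v U * (if tabloid_action \<beta> m U = T then 1 else 0))"
    using fin by (intro sum.mono_neutral_cong_left) (auto split: if_splits)
  also have "\<dots> = (\<Sum>m\<in>?H. \<Sum>U\<in>?T. ?x m * v U * (if tabloid_action \<beta> m U = T then 1 else 0))"
    by (simp add: sum.cartesian_product)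
  also have "\<dots> = (\<Sum>U\<in>?T. \<Sum>m\<in>?H. ?x m * v U * (if tabloid_action \<beta> m U = T then 1 else 0))"
    by (rule sum.swap)
  also have "\<dots> = (\<Sum>U\<in>?T. v U * (\<Sum>\<sigma>\<in>?C. of_int (sign \<sigma>) *
      (if tabloid_action \<beta> (perm_mor ?k \<sigma>) U = T then 1 else 0)))"
  proof (rule sum.cong[OF refl])
    fix U
    let ?g = "\<lambda>m. if tabloid_action \<beta> m U = T then 1 else (0::complex)"
    have "(\<Sum>m\<in>?H. ?x m * v U * ?g m) =
        (\<Sum>m\<in>?H. \<Sum>\<sigma>\<in>?C. if perm_mor ?k \<sigma> = m then of_int (sign \<sigma>) * v U * ?g m else 0)"
      unfolding antisymmetrizer_def sum_distrib_right by (intro sum.cong refl) simp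
    also have "\<dots> = (\<Sum>\<sigma>\<in>?C. \<Sum>m\<in>?H. if perm_mor ?k \<sigma> = m then of_int (sign \<sigma>) * v U * ?g m else 0)"
      by (rule sum.swap)
    also have "\<dots> = (\<Sum>\<sigma>\<in>?C. of_int (sign \<sigma>) * v U * ?g (perm_mor ?k \<sigma>))"
      using fin perm_mor_hom column_stabilizer_permutes
      by (intro sum.cong refl) (auto simp: sum.delta')
    also have "\<dots> = v U * (\<Sum>\<sigma>\<in>?C. of_int (sign \<sigma>) * ?g (perm_mor ?k \<sigma>))"
      unfolding sum_distrib_left by (intro sum.cong refl) simp
    finally show "(\<Sum>m\<in>?H. ?x m * v U * ?g m) =
      v U * (\<Sum>\<sigma>\<in>?C. of_int (sign \<sigma>) * ?g (perm_mor ?k \<sigma>))" .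
  qed
  finally show ?thesis .
qed

text \<open>
  If two numbers \<open>a \<noteq> b\<close> lie in the same row of \<open>s\<close> and in the same column of \<open>t\<close>, then their
  transposition is an odd element of the column stabilizer of \<open>t\<close> that fixes the tabloid of \<open>s\<close>, so the terms of
  the antisymmetrizer cancel in pairs on this tabloid. A tabloid on which the antisymmetrizer does not
  vanish therefore satisfies the hypothesis of \<open>dominance\<close>.
\<close>

lemma antisymmetrizer_dominance:
  assumes t: "t \<in> tableaux \<alpha>" and sum: "sum_list \<beta> = sum_list \<alpha>" and \<alpha>: "sorted_wrt (\<ge>) \<alpha>"
    and nz: "acts_nonconstantly (specht_module \<beta>) (antisymmetrizer \<alpha> t)"
  shows "sum_list (take r \<beta>) \<le> sum_list (take r \<alpha>)"
proof -
  let ?k = "sum_list \<alpha>" and ?C = "column_stabilizer \<alpha> t" and ?T = "tabloid \<beta> ` tableaux \<beta>"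
  let ?c = "\<lambda>U T. \<Sum>\<sigma>\<in>?C. of_int (sign \<sigma>) *
      (if tabloid_action \<beta> (perm_mor ?k \<sigma>) U = T then 1 else (0::complex))"
  have "\<exists>U\<in>?T. \<exists>T. ?c U T \<noteq> 0"
  proof (rule ccontr)
    assume "\<not> ?thesis"
    then have zero: "?c U T = 0" if "U \<in> ?T" for U T
      using that by blast
    have "antisymmetrizer \<alpha> t \<odot>\<^bsub>specht_module \<beta>\<^esub> v = (\<lambda>T. 0)" for v
      unfolding antisymmetrizer_smult[OF sum]
      by (intro ext sum.neutral ballI) (simp only: zero mult_zero_right)
    then show False
      using nz by (simp add: acts_nonconstantly_def)
  qed
  then obtain s T where s: "s \<in> tableaux \<beta>" and c: "?c (tabloid \<beta> s) T \<noteq> 0"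
    by blast
  show ?thesis
  proof (rule dominance[OF s t sum \<alpha>], rule ccontr)
    fix a b i j
    assume row: "a \<in> row_entries \<beta> s i" "b \<in> row_entries \<beta> s i"
      and col: "a \<in> column_entries \<alpha> t j" "b \<in> column_entries \<alpha> t j" and "a \<noteq> b"
    let ?\<tau> = "Transposition.transpose a b"
    have "a \<in> {1..?k}" "b \<in> {1..?k}"
      using col tableau_mem[OF t] by (auto simp: column_entries_iff)
    then have \<tau>: "?\<tau> permutes {1..?k}"
      by (rule permutes_swap_id)
    have "a \<in> column_entries \<alpha> t j' \<longleftrightarrow> b \<in> column_entries \<alpha> t j'" for j'
      using column_entries_disjoint[OF t] col by blast
    then have \<tau>C: "?\<tau> \<in> ?C"
      using \<tau> by (simp add: column_stabilizer_def)
    have "a \<in> row_entries \<beta> s i' \<longleftrightarrow> b \<in> row_entries \<beta> s i'" for i'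
      using row_entries_disjoint[OF s] row by blast
    then have fixed: "tabloid \<beta> (act \<beta> ?\<tau> s) = tabloid \<beta> s"
      using act_tableau[OF _ s, of ?\<tau>] \<tau> sum s by (simp add: tabloid_eq_iff row_entries_act)
    have action: "tabloid_action \<beta> (perm_mor ?k (\<sigma> \<circ> ?\<tau>)) (tabloid \<beta> s) =
        tabloid_action \<beta> (perm_mor ?k \<sigma>) (tabloid \<beta> s)" if "\<sigma> \<in> ?C" for \<sigma>
    proof -
      note \<sigma> = column_stabilizer_permutes[OF that]
      have \<tau>s: "act \<beta> ?\<tau> s \<in> tableaux \<beta>"
        using act_tableau[OF _ s] \<tau> sum by simp
      have "tabloid_action \<beta> (perm_mor ?k (\<sigma> \<circ> ?\<tau>)) (tabloid \<beta> s) = tabloid \<beta> (act \<beta> \<sigma> (act \<beta> ?\<tau> s))"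
        using tabloid_action_perm[of "\<sigma> \<circ> ?\<tau>" \<beta> s] permutes_compose[OF \<tau> \<sigma>] s sum by (simp add: act_act)
      also have "\<dots> = tabloid_action \<beta> (perm_mor ?k \<sigma>) (tabloid \<beta> (act \<beta> ?\<tau> s))"
        using tabloid_action_perm[of \<sigma> \<beta>, OF _ \<tau>s] \<sigma> sum by simp
      finally show ?thesis
        by (simp add: fixed)
    qed
    have sgn: "sign (\<sigma> \<circ> ?\<tau>) = - sign \<sigma>" if "\<sigma> \<in> ?C" for \<sigma>
      using sign_compose[of \<sigma> ?\<tau>] column_stabilizer_permutes[OF that] \<tau> \<open>a \<noteq> b\<close>
      by (simp add: permutes_imp_permutation[of "{1..?k}"] sign_swap_id)
    have "?c (tabloid \<beta> s) T = (\<Sum>\<sigma>\<in>?C. of_int (sign (\<sigma> \<circ> ?\<tau>)) *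
      (if tabloid_action \<beta> (perm_mor ?k (\<sigma> \<circ> ?\<tau>)) (tabloid \<beta> s) = T then 1 else 0))"
      by (rule sum.reindex_bij_witness[of _ "\<lambda>\<sigma>. \<sigma> \<circ> ?\<tau>" "\<lambda>\<sigma>. \<sigma> \<circ> ?\<tau>"])
        (use column_stabilizer_comp[OF _ \<tau>C] in \<open>simp_all add: comp_assoc\<close>)
    also have "\<dots> = - ?c (tabloid \<beta> s) T"
      unfolding sum_negf[symmetric] using sgn action by (intro sum.cong refl) simp
    finally show False
      using c by (simp add: eq_neg_iff_add_eq_0)
  qed
qed

text \<open>
  The antisymmetrizer multiplies the polytabloid by the order of the column stabilizer, and
  the coefficient of the polytabloid at its own tabloid is one. The computation stays at this
  coefficient: a pair \<open>\<sigma>, \<pi>\<close> contributes to it only if \<open>\<sigma> \<circ> \<pi>\<close> is the identity.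
\<close>

lemma antisymmetrizer_polytabloid:
  assumes t: "t \<in> tableaux \<alpha>"
  shows "(antisymmetrizer \<alpha> t \<odot>\<^bsub>specht_module \<alpha>\<^esub> polytabloid \<alpha> t) (tabloid \<alpha> t) =
    of_nat (card (column_stabilizer \<alpha> t))"
proof -
  let ?k = "sum_list \<alpha>" and ?C = "column_stabilizer \<alpha> t" and ?T = "tabloid \<alpha> ` tableaux \<alpha>"
  let ?g = "\<lambda>\<sigma> U. if tabloid_action \<alpha> (perm_mor ?k \<sigma>) U = tabloid \<alpha> t then 1 else (0::complex)"
  let ?s = "\<lambda>\<pi>. of_int (sign \<pi>) :: complex"
  have "(antisymmetrizer \<alpha> t \<odot>\<^bsub>specht_module \<alpha>\<^esub> polytabloid \<alpha> t) (tabloid \<alpha> t) =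
      (\<Sum>U\<in>?T. \<Sum>\<pi>\<in>?C. if tabloid \<alpha> (act \<alpha> \<pi> t) = U then ?s \<pi> * (\<Sum>\<sigma>\<in>?C. ?s \<sigma> * ?g \<sigma> U) else 0)"
    unfolding antisymmetrizer_smult[OF refl] polytabloid_def sum_distrib_right
    by (intro sum.cong refl) simp
  also have "\<dots> = (\<Sum>\<pi>\<in>?C. \<Sum>U\<in>?T. if tabloid \<alpha> (act \<alpha> \<pi> t) = U then ?s \<pi> * (\<Sum>\<sigma>\<in>?C. ?s \<sigma> * ?g \<sigma> U) else 0)"
    by (rule sum.swap)
  also have "\<dots> = (\<Sum>\<pi>\<in>?C. ?s \<pi> * (\<Sum>\<sigma>\<in>?C. ?s \<sigma> * ?g \<sigma> (tabloid \<alpha> (act \<alpha> \<pi> t))))"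
    using act_tableau[OF column_stabilizer_permutes t] finite_tableaux
    by (intro sum.cong refl) (auto simp: sum.delta')
  also have "\<dots> = (\<Sum>\<pi>\<in>?C. 1)"
  proof (rule sum.cong[OF refl])
    fix \<pi> assume \<pi>: "\<pi> \<in> ?C"
    note \<pi>p = column_stabilizer_permutes[OF \<pi>]
    have "?g \<sigma> (tabloid \<alpha> (act \<alpha> \<pi> t)) = (if \<sigma> = inv_into UNIV \<pi> then 1 else 0)" if \<sigma>: "\<sigma> \<in> ?C" for \<sigma>
    proof -
      note \<sigma>p = column_stabilizer_permutes[OF \<sigma>]
      have \<sigma>\<pi>: "\<sigma> \<circ> \<pi> \<in> ?C"
        using \<sigma> \<pi> by (rule column_stabilizer_comp)
      have act: "tabloid_action \<alpha> (perm_mor ?k \<sigma>) (tabloid \<alpha> (act \<alpha> \<pi> t)) = tabloid \<alpha> (act \<alpha> (\<sigma> \<circ> \<pi>) t)"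
        using tabloid_action_perm[OF \<sigma>p act_tableau[OF \<pi>p t]] by (simp add: act_act)
      have "tabloid \<alpha> (act \<alpha> (\<sigma> \<circ> \<pi>) t) = tabloid \<alpha> t \<longleftrightarrow> \<sigma> \<circ> \<pi> = id"
      proof
        assume "tabloid \<alpha> (act \<alpha> (\<sigma> \<circ> \<pi>) t) = tabloid \<alpha> t"
        then show "\<sigma> \<circ> \<pi> = id"
          using act_tableau[OF column_stabilizer_permutes[OF \<sigma>\<pi>] t] t
          by (intro row_column_stabilizer_trivial[OF t \<sigma>\<pi>]) (simp add: tabloid_eq_iff row_entries_act)
      qed (use act_id[OF t] in simp)
      also have "\<dots> \<longleftrightarrow> \<sigma> = inv_into UNIV \<pi>"
      proof
        assume "\<sigma> \<circ> \<pi> = id"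
        then have "\<sigma> \<circ> (\<pi> \<circ> inv_into UNIV \<pi>) = inv_into UNIV \<pi>"
          by (simp add: comp_assoc[symmetric])
        then show "\<sigma> = inv_into UNIV \<pi>"
          using permutes_inv_o(1)[OF \<pi>p] by simp
      qed (use permutes_inv_o(2)[OF \<pi>p] in simp)
      finally show ?thesis
        by (simp add: act)
    qed
    then have "(\<Sum>\<sigma>\<in>?C. ?s \<sigma> * ?g \<sigma> (tabloid \<alpha> (act \<alpha> \<pi> t))) = (\<Sum>\<sigma>\<in>?C. if \<sigma> = inv_into UNIV \<pi> then ?s \<sigma> else 0)"
      by (intro sum.cong refl) simp
    also have "\<dots> = ?s (inv_into UNIV \<pi>)"
      using column_stabilizer_inv[OF \<pi>] finite_column_stabilizer by (simp add: sum.delta)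
    also have "\<dots> = ?s \<pi>"
      using sign_inverse[of \<pi>] permutes_imp_permutation[OF _ \<pi>p] by simp
    finally show "?s \<pi> * (\<Sum>\<sigma>\<in>?C. ?s \<sigma> * ?g \<sigma> (tabloid \<alpha> (act \<alpha> \<pi> t))) = 1"
      by (simp add: sign_def)
  qed
  also have "\<dots> = of_nat (card ?C)"
    by simp
  finally show ?thesis .
qed

text \<open>
  The order of the column stabilizer is nonzero in characteristic zero.
\<close>

lemma antisymmetrizer_acts:
  assumes t: "t \<in> tableaux \<alpha>"
  shows "acts_nonconstantly (specht_module \<alpha>) (antisymmetrizer \<alpha> t)"
proof -
  let ?M = "specht_module \<alpha>"
  have comb: "(\<lambda>T. \<Sum>s\<in>tableaux \<alpha>. c s * polytabloid \<alpha> s T) \<in> carrier ?M" for c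
    by (auto simp: specht_module_def)
  have "polytabloid \<alpha> t \<in> carrier ?M"
    using comb[of "\<lambda>s. if s = t then 1 else 0"] t finite_tableaux
    by (simp add: if_distrib[where f = "\<lambda>x. x * y" for y] sum.delta cong: if_cong)
  moreover have "(\<lambda>T. 0) \<in> carrier ?M"
    using comb[of "\<lambda>s. 0"] by simp
  moreover have "antisymmetrizer \<alpha> t \<odot>\<^bsub>?M\<^esub> polytabloid \<alpha> t \<noteq> antisymmetrizer \<alpha> t \<odot>\<^bsub>?M\<^esub> (\<lambda>T. 0)"
  proof
    assume eq: "antisymmetrizer \<alpha> t \<odot>\<^bsub>?M\<^esub> polytabloid \<alpha> t = antisymmetrizer \<alpha> t \<odot>\<^bsub>?M\<^esub> (\<lambda>T. 0)"
    have "of_nat (card (column_stabilizer \<alpha> t)) = (0::complex)"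
      unfolding antisymmetrizer_polytabloid[OF t, symmetric] eq by (simp add: antisymmetrizer_smult)
    then show False
      using finite_column_stabilizer[of \<alpha> t] id_column_stabilizer[of \<alpha> t] by auto
  qed
  ultimately show ?thesis
    unfolding acts_nonconstantly_def by blast
qed

theorem specht_modules_distinct:
  assumes "\<alpha> \<in> young_diagrams k" "\<beta> \<in> young_diagrams k"
    and iff: "\<And>a. a \<in> carrier (CS k) \<Longrightarrow>
      acts_nonconstantly (specht_module \<alpha>) a \<longleftrightarrow> acts_nonconstantly (specht_module \<beta>) a"
  shows "\<alpha> = \<beta>"
proof (rule partial_sums_inject)
  show "0 \<notin> set \<alpha>" "0 \<notin> set \<beta>"
    using assms by (auto simp: young_diagrams_def)
  have sums: "sum_list \<alpha> = k" "sum_list \<beta> = k" and sorted: "sorted_wrt (\<ge>) \<alpha>" "sorted_wrt (\<ge>) \<beta>"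
    using assms by (auto simp: young_diagrams_def)
  obtain s t where s: "s \<in> tableaux \<alpha>" and t: "t \<in> tableaux \<beta>"
    using tableau_exists by blast
  fix r
  have "acts_nonconstantly (specht_module \<beta>) (antisymmetrizer \<alpha> s)"
    using iff[of "antisymmetrizer \<alpha> s"] antisymmetrizer_acts[OF s] antisymmetrizer_closed[of \<alpha> s] sums by simp
  then have "sum_list (take r \<beta>) \<le> sum_list (take r \<alpha>)"
    using antisymmetrizer_dominance[OF s _ sorted(1)] sums by simp
  moreover have "acts_nonconstantly (specht_module \<alpha>) (antisymmetrizer \<beta> t)"
    using iff[of "antisymmetrizer \<beta> t"] antisymmetrizer_acts[OF t] antisymmetrizer_closed[of \<beta> t] sums by simp
  then have "sum_list (take r \<alpha>) \<le> sum_list (take r \<beta>)"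
    using antisymmetrizer_dominance[OF t _ sorted(2)] sums by simp
  ultimately show "sum_list (take r \<alpha>) = sum_list (take r \<beta>)"
    by simp
qed

section \<open>The Cartan matrix\<close>

lemma ideal_acts_iff_specht:
  assumes prim: "primitive_idempotent (CS k) e"
    and iso: "module_iso (CS k) (left_ideal_module (CS k) e) (specht_module \<alpha>)"
    and a: "a \<in> carrier (CS k)"
  shows "acts_nonconstantly (left_ideal_module (CS k) e) a \<longleftrightarrow> acts_nonconstantly (specht_module \<alpha>) a"
proof -
  have "ring (CS k)"
    by (rule ring_SE_algebra) simp
  then have "left_module (CS k) (left_ideal_module (CS k) e)"
    using prim by (intro ring.left_ideal_left_module) (simp_all add: primitive_idempotent_def)
  from left_module.smult_closed[OF this a] show ?thesis
    by (rule acts_nonconstantly_iso[OF iso a])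
qed

text \<open>
  Isomorphic modules are annihilated by the same elements, in particular by the same elements of
  the group algebra.
\<close>

lemma top_modules_distinct:
  assumes k: "k \<le> n" and \<alpha>: "\<alpha> \<in> young_diagrams k" and \<beta>: "\<beta> \<in> young_diagrams k"
    and e: "primitive_idempotent (CS k) e" "module_iso (CS k) (left_ideal_module (CS k) e) (specht_module \<alpha>)"
    and f: "primitive_idempotent (CS k) f" "module_iso (CS k) (left_ideal_module (CS k) f) (specht_module \<beta>)"
    and iso: "module_iso (CSE n) (top_module n e) (top_module n f)"
  shows "\<alpha> = \<beta>"
proof (rule specht_modules_distinct[OF \<alpha> \<beta>])
  fix a assume a: "a \<in> carrier (CS k)"
  note aR = CS_sub[OF k e(1) a]
  have "acts_nonconstantly (specht_module \<alpha>) a \<longleftrightarrow> acts_nonconstantly (top_module n e) a"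
    unfolding top_acts_iff[OF k e(1) a] ideal_acts_iff_specht[OF e a] ..
  also have "\<dots> \<longleftrightarrow> acts_nonconstantly (top_module n f) a"
    using acts_nonconstantly_iso[OF iso aR] left_module.smult_closed[OF top_left_module[OF k e(1)] aR] .
  also have "\<dots> \<longleftrightarrow> acts_nonconstantly (specht_module \<beta>) a"
    unfolding top_acts_iff[OF k f(1) a] ideal_acts_iff_specht[OF f a] ..
  finally show "acts_nonconstantly (specht_module \<alpha>) a \<longleftrightarrow> acts_nonconstantly (specht_module \<beta>) a" .
qed

lemma diagram_block_index:
  assumes "a < dim_row (diagram_block ds C i j)" "b < dim_col (diagram_block ds C i j)"
    and C: "dim_row C = length ds" "dim_col C = length ds"
  defines "I \<equiv> {p. p < length ds \<and> ds ! p \<in> young_diagrams (i - 1)}"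
    and "J \<equiv> {q. q < length ds \<and> ds ! q \<in> young_diagrams (j - 1)}"
  shows "diagram_block ds C i j $$ (a, b) = C $$ (pick I a, pick J b)"
    and "pick I a \<in> I" "pick J b \<in> J" "a < card I" "b < card J"
proof -
  have "{p. p < dim_row C \<and> p \<in> I} = I" "{q. q < dim_col C \<and> q \<in> J} = J"
    using C by (auto simp: I_def J_def)
  then show card: "a < card I" "b < card J"
    using assms(1,2) unfolding diagram_block_def I_def[symmetric] J_def[symmetric] dim_submatrix by simp_all
  then show "pick I a \<in> I" "pick J b \<in> J"
    by (auto intro: pick_in_set_le)
  show "diagram_block ds C i j $$ (a, b) = C $$ (pick I a, pick J b)"
    using assms(1,2) unfolding diagram_block_def I_def[symmetric] J_def[symmetric] dim_submatrix
    by (rule submatrix_index)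
qed

lemma pick_inject: "a < card I \<Longrightarrow> b < card I \<Longrightarrow> pick I a = pick I b \<longleftrightarrow> a = b"
  using pick_mono_le[of a I b] pick_mono_le[of b I a] by (metis linorder_neq_iff less_irrefl)

theorem lemma4p3:
  fixes n :: nat
    and e :: "nat list \<Rightarrow> se_mor \<Rightarrow> complex"
    and ds :: "nat list list"
  assumes idempotents: "\<And>k \<alpha>. k \<le> n \<Longrightarrow> \<alpha> \<in> young_diagrams k \<Longrightarrow>
      primitive_idempotent (CS k) (e \<alpha>) \<and>
      module_iso (CS k) (left_ideal_module (CS k) (e \<alpha>)) (specht_module \<alpha>)"
    and diagrams: "distinct ds" "set ds = (\<Union>k\<in>{0..n}. young_diagrams k)"
    and ordered: "\<And>p q r k. p < length ds \<Longrightarrow> q < length ds \<Longrightarrow>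
      ds ! p \<in> young_diagrams r \<Longrightarrow> ds ! q \<in> young_diagrams k \<Longrightarrow> r < k \<Longrightarrow> p < q"
  shows "block_upper_unitriangular (n + 1) (diagram_block ds (cartan_matrix n e ds))"
proof -
  let ?C = "cartan_matrix n e ds"
  let ?B = "diagram_block ds ?C"
  let ?I = "\<lambda>i. {p. p < length ds \<and> ds ! p \<in> young_diagrams (i - 1)}"
  have dims: "dim_row ?C = length ds" "dim_col ?C = length ds"
    by (simp_all add: cartan_matrix_def)
  have entry: "?C $$ (p, q) =
      jh_multiplicity (CSE n) (proj_module n (e (ds ! q))) (top_module n (e (ds ! p)))"
    if "p < length ds" "q < length ds" for p q
    using that by (simp add: cartan_matrix_def)
  have below: "?C $$ (p, q) = 0"
    if p: "p < length ds" "ds ! p \<in> young_diagrams l" and q: "q < length ds" "ds ! q \<in> young_diagrams k"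
      and "k < l" "l \<le> n" for p q k l
  proof -
    have "k \<le> n"
      using \<open>k < l\<close> \<open>l \<le> n\<close> by simp
    show ?thesis
      unfolding entry[OF p(1) q(1)]
      using idempotents[OF \<open>k \<le> n\<close> q(2)] idempotents[OF \<open>l \<le> n\<close> p(2)] \<open>k \<le> n\<close> \<open>k < l\<close> \<open>l \<le> n\<close>
      by (intro jh_multiplicity_proj_above[of k _ _ l] top_acts_unit) auto
  qed
  have diagonal: "?C $$ (p, q) = (if p = q then 1 else 0)"
    if p: "p < length ds" "ds ! p \<in> young_diagrams k" and q: "q < length ds" "ds ! q \<in> young_diagrams k"
      and k: "k \<le> n" for p q k
  proof -
    note P = idempotents[OF k p(2)] and Q = idempotents[OF k q(2)]
    have "module_iso (CSE n) (top_module n (e (ds ! q))) (top_module n (e (ds ! p))) \<longleftrightarrow> p = q"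
    proof
      assume "module_iso (CSE n) (top_module n (e (ds ! q))) (top_module n (e (ds ! p)))"
      then have "ds ! q = ds ! p"
        using P Q by (intro top_modules_distinct[OF k q(2) p(2)]) blast+
      then show "p = q"
        using diagrams(1) p(1) q(1) by (simp add: nth_eq_iff_index_eq)
    qed (simp add: module_iso_refl)
    moreover have "?C $$ (p, q) =
        (if module_iso (CSE n) (top_module n (e (ds ! q))) (top_module n (e (ds ! p))) then 1 else 0)"
      unfolding entry[OF p(1) q(1)]
      using P Q by (intro jh_multiplicity_proj_top[OF k] top_acts_unit[OF k]) blast+
    ultimately show ?thesis
      by simp
  qed
  show ?thesis
    unfolding block_upper_unitriangular_def
  proof (intro conjI ballI impI)
    fix i j assume i: "i \<in> {1..n + 1}" and j: "j \<in> {1..n + 1}" and "j < i"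
    show "?B i j = 0\<^sub>m (dim_row (?B i j)) (dim_col (?B i j))"
    proof (rule eq_matI)
      fix a b
      assume "a < dim_row (0\<^sub>m (dim_row (?B i j)) (dim_col (?B i j)) :: nat mat)"
        and "b < dim_col (0\<^sub>m (dim_row (?B i j)) (dim_col (?B i j)) :: nat mat)"
      then have ab: "a < dim_row (?B i j)" "b < dim_col (?B i j)"
        by simp_all
      note idx = diagram_block_index[OF ab dims]
      have "?C $$ (pick (?I i) a, pick (?I j) b) = 0"
        using idx(2,3) i j \<open>j < i\<close> by (intro below[of _ "i - 1" _ "j - 1"]) auto
      then show "?B i j $$ (a, b) = 0\<^sub>m (dim_row (?B i j)) (dim_col (?B i j)) $$ (a, b)"
        using ab idx(1) by simp
    qed simp_all
  next
    fix i assume i: "i \<in> {1..n + 1}"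
    have square: "dim_col (?B i i) = dim_row (?B i i)"
      by (simp add: diagram_block_def dim_submatrix dims)
    show "?B i i = 1\<^sub>m (dim_row (?B i i))"
    proof (rule eq_matI)
      fix a b
      assume "a < dim_row (1\<^sub>m (dim_row (?B i i)) :: nat mat)"
        and "b < dim_col (1\<^sub>m (dim_row (?B i i)) :: nat mat)"
      then have ab: "a < dim_row (?B i i)" "b < dim_col (?B i i)"
        by (simp_all add: square)
      note idx = diagram_block_index[OF ab dims]
      have "?C $$ (pick (?I i) a, pick (?I i) b) = (if pick (?I i) a = pick (?I i) b then 1 else 0)"
        using idx(2,3) i by (intro diagonal[of _ "i - 1"]) auto
      then show "?B i i $$ (a, b) = 1\<^sub>m (dim_row (?B i i)) $$ (a, b)"
        using ab idx(1) pick_inject[OF idx(4,5)] square by simp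
    qed (simp_all add: square)
  qed
qed

end
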